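(* There is an algorithm (the greedy flip algorithm) which, given a finite Coxeter system $(W,S)$ of rank $n$, a word $Q$ of length $m$ on $S$, and an element $\rho\in W$ such that $Q$ contains a reduced expression of $\rho$, generates all facets of the subword complex $\mathcal{SC}(Q,\rho)$ with running time per facet in $O(m^2 n)$ and working space in $O(mn)$.
   Context: Let $(W,S)$ be a finite Coxeter system of rank $n=|S|$, acting on an $n$-dimensional euclidean vector space $V$ as a finite reflection group, with root system $\Phi$ and simple roots $\Delta$. For a word $Q=q_1\cdots q_m$ on $S$ and $\rho\in W$, the subword complex $\mathcal{SC}(Q,\rho)$ is the simplicial complex on the set of positions $[m]=\{1,\dots,m\}$ whose facets are the complements of the sets of positions forming a reduced expression of $\rho$ in $Q$. Neither $n$ nor $m$ is considered constant, and the implied constants are absolute. Time is counted in elementary operations, an arithmetic operation or comparison on coordinates of vectors of $V$ counting as one operation, so that a reflection of a given vector in $V$ along a given root takes $O(n)$ time and a vector of $V$ occupies $O(n)$ space. Working space is the memory used during the execution, not counting the produced list of facets; running time per facet is the total running time divided by the number of facets. *)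

theory Defs
  imports
    "HOL-Algebra.Generated_Groups"
    "HOL-Algebra.Multiplicative_Group"
    "Jordan_Normal_Form.Matrix"
begin

section \<open>Coxeter systems, reduced expressions and subword complexes\<close>

definition word_prod :: "('g, 'x) monoid_scheme \<Rightarrow> 'g list \<Rightarrow> 'g" where
  "word_prod G ws = foldr (\<lambda>s w. s \<otimes>\<^bsub>G\<^esub> w) ws \<one>\<^bsub>G\<^esub>"

text \<open>One insertion of a Coxeter relator \<open>(st)\<^sup>m\<close>, where \<open>m\<close> is the order of \<open>st\<close>. For \<open>s = t\<close> the
  order is 1 and the relator is \<open>ss\<close>. Since every generator is its own inverse, the monoid
  presentation with these relators is the Coxeter group presentation.\<close>

definition coxeter_step :: "('g, 'x) monoid_scheme \<Rightarrow> 'g set \<Rightarrow> 'g list \<Rightarrow> 'g list \<Rightarrow> bool" where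
  "coxeter_step G S us vs \<longleftrightarrow>
     (\<exists>xs ys. \<exists>s\<in>S. \<exists>t\<in>S. us = xs @ ys \<and>
        vs = xs @ concat (replicate (group.ord G (s \<otimes>\<^bsub>G\<^esub> t)) [s, t]) @ ys)"

definition coxeter_system :: "('g, 'x) monoid_scheme \<Rightarrow> 'g set \<Rightarrow> bool" where
  "coxeter_system G S \<longleftrightarrow>
     group G \<and> finite S \<and> S \<subseteq> carrier G \<and> generate G S = carrier G \<and>
     (\<forall>s\<in>S. group.ord G s = 2) \<and>
     (\<forall>us\<in>lists S. \<forall>vs\<in>lists S.
        word_prod G us = word_prod G vs \<longrightarrow> equivclp (coxeter_step G S) us vs)"

definition coxeter_length :: "('g, 'x) monoid_scheme \<Rightarrow> 'g set \<Rightarrow> 'g \<Rightarrow> nat" where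
  "coxeter_length G S w = (LEAST k. \<exists>ws\<in>lists S. word_prod G ws = w \<and> length ws = k)"

definition reduced_expression ::
    "('g, 'x) monoid_scheme \<Rightarrow> 'g set \<Rightarrow> 'g list \<Rightarrow> 'g \<Rightarrow> bool" where
  "reduced_expression G S ws w \<longleftrightarrow>
     ws \<in> lists S \<and> word_prod G ws = w \<and> length ws = coxeter_length G S w"

text \<open>Positions in a word are counted from 1.\<close>

definition subword :: "'g list \<Rightarrow> nat set \<Rightarrow> 'g list" where
  "subword Q J = nths Q {k. Suc k \<in> J}"

definition subword_complex ::
    "('g, 'x) monoid_scheme \<Rightarrow> 'g set \<Rightarrow> 'g list \<Rightarrow> 'g \<Rightarrow> nat set set" where
  "subword_complex G S Q \<rho> =
     {F. \<exists>J. J \<subseteq> {1..length Q} \<and> reduced_expression G S (subword Q J) \<rho> \<and>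
             F \<subseteq> {1..length Q} - J}"

definition facets :: "'p set set \<Rightarrow> 'p set set" where
  "facets K = {F \<in> K. \<forall>F'\<in>K. F \<subseteq> F' \<longrightarrow> F' = F}"


section \<open>Finite reflection groups on euclidean \<open>n\<close>-space\<close>

text \<open>Matrix of the orthogonal reflection that sends \<open>\<alpha>\<close> to \<open>-\<alpha>\<close>.\<close>

definition refl_mat :: "nat \<Rightarrow> real vec \<Rightarrow> real mat" where
  "refl_mat n \<alpha> =
     mat n n (\<lambda>(i, j). (if i = j then 1 else 0) - 2 * (\<alpha> $ i) * (\<alpha> $ j) / (\<alpha> \<bullet> \<alpha>))"

definition root_system :: "nat \<Rightarrow> real vec set \<Rightarrow> bool" where
  "root_system n \<Phi> \<longleftrightarrow>
     finite \<Phi> \<and> \<Phi> \<subseteq> carrier_vec n \<and> 0\<^sub>v n \<notin> \<Phi> \<and>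
     (\<forall>\<alpha>\<in>\<Phi>. {\<beta> \<in> \<Phi>. \<exists>c. \<beta> = c \<cdot>\<^sub>v \<alpha>} = {\<alpha>, - \<alpha>}) \<and>
     (\<forall>\<alpha>\<in>\<Phi>. \<forall>\<beta>\<in>\<Phi>. refl_mat n \<alpha> *\<^sub>v \<beta> \<in> \<Phi>)"

text \<open>The list \<open>\<Delta>\<close> of simple roots is a basis of the whole space, in which every root has
  coordinates all nonnegative or all nonpositive.\<close>

definition simple_roots :: "nat \<Rightarrow> real vec set \<Rightarrow> real vec list \<Rightarrow> bool" where
  "simple_roots n \<Phi> \<Delta> \<longleftrightarrow>
     length \<Delta> = n \<and> set \<Delta> \<subseteq> \<Phi> \<and>
     (\<forall>v\<in>carrier_vec n. \<exists>!c. c \<in> carrier_vec n \<and> mat_of_cols n \<Delta> *\<^sub>v c = v) \<and>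
     (\<forall>\<beta>\<in>\<Phi>. \<exists>c\<in>carrier_vec n. mat_of_cols n \<Delta> *\<^sub>v c = \<beta> \<and>
        ((\<forall>i<n. 0 \<le> c $ i) \<or> (\<forall>i<n. c $ i \<le> 0)))"

definition reflection_group :: "nat \<Rightarrow> real vec set \<Rightarrow> real mat monoid" where
  "reflection_group n \<Phi> =
     subgroup_generated (units_of (ring_mat TYPE(real) n ())) (refl_mat n ` \<Phi>)"

definition simple_reflections :: "nat \<Rightarrow> real vec list \<Rightarrow> real mat set" where
  "simple_reflections n \<Delta> = refl_mat n ` set \<Delta>"

text \<open>Letters are encoded by the indices \<open>i < n\<close> of the simple roots.\<close>

definition word_of :: "nat \<Rightarrow> real vec list \<Rightarrow> nat list \<Rightarrow> real mat list" where
  "word_of n \<Delta> is = map (\<lambda>i. refl_mat n (\<Delta> ! i)) is"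

definition finite_coxeter_data ::
    "nat \<Rightarrow> real mat monoid \<Rightarrow> real mat set \<Rightarrow> real vec set \<Rightarrow> real vec list \<Rightarrow> bool" where
  "finite_coxeter_data n W S \<Phi> \<Delta> \<longleftrightarrow>
     root_system n \<Phi> \<and> simple_roots n \<Phi> \<Delta> \<and>
     W = reflection_group n \<Phi> \<and> S = simple_reflections n \<Delta> \<and>
     finite (carrier W) \<and> coxeter_system W S \<and> card S = n"


section \<open>The model of computation\<close>

text \<open>
  A random access machine with unit-cost arithmetic and comparisons on real coordinates and with
  natural numbers for indices. The input is read-only, the output is write-only, and neither
  belongs to the working memory. Natural numbers have addition and truncated subtraction only,
  and 0 and 1 are the only real constants, so that neither a long computation on big integers nor
  an uncomputable real can be hidden in one operation.

  The input consists of the rank, a word, the coordinates of the simple roots, and a reduced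
  expression of the group element.
\<close>

record machine_input =
  in_rank :: nat
  in_word :: "nat list"
  in_roots :: "real vec list"
  in_elem :: "nat list"

type_synonym name = string

text \<open>All memory cells are array cells; a scalar variable is an array used at index 0 only.\<close>

datatype iexp =
    IConst nat
  | Rank
  | WordLen
  | ElemLen
  | WordLetter iexp
  | ElemLetter iexp
  | IGet name iexp
  | IPlus iexp iexp
  | IMinus iexp iexp

datatype rexp =
    RZero
  | ROne
  | RootCoord iexp iexp
  | RGet name iexp iexp
  | RPlus rexp rexp
  | RMinus rexp rexp
  | RTimes rexp rexp
  | RDivide rexp rexp

datatype bexp =
    ILess iexp iexp
  | RLess rexp rexp
  | BNot bexp
  | BAnd bexp bexp

text \<open>\<open>Emit\<close> appends a position to the facet being output; \<open>EndFacet\<close> completes that facet.\<close>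

datatype com =
    Skip
  | ISet name iexp iexp
  | RSet name iexp iexp rexp
  | Emit iexp
  | EndFacet
  | Seq com com
  | IfElse bexp com com
  | While bexp com

record state =
  imem :: "name \<Rightarrow> nat \<Rightarrow> nat"
  rmem :: "name \<Rightarrow> nat \<Rightarrow> nat \<Rightarrow> real"
  pending :: "nat list"
  produced :: "nat list list"

definition init_state :: state where
  "init_state = \<lparr>imem = (\<lambda>_ _. 0), rmem = (\<lambda>_ _ _. 0), pending = [], produced = []\<rparr>"

definition read :: "nat list \<Rightarrow> nat \<Rightarrow> nat" where
  "read xs k = (if k < length xs then xs ! k else 0)"

definition read_root :: "machine_input \<Rightarrow> nat \<Rightarrow> nat \<Rightarrow> real" where
  "read_root I i j =
     (if i < length (in_roots I) \<and> j < in_rank I then in_roots I ! i $ j else 0)"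

fun ival :: "machine_input \<Rightarrow> state \<Rightarrow> iexp \<Rightarrow> nat" where
  "ival I s (IConst k) = k"
| "ival I s Rank = in_rank I"
| "ival I s WordLen = length (in_word I)"
| "ival I s ElemLen = length (in_elem I)"
| "ival I s (WordLetter e) = read (in_word I) (ival I s e)"
| "ival I s (ElemLetter e) = read (in_elem I) (ival I s e)"
| "ival I s (IGet x e) = imem s x (ival I s e)"
| "ival I s (IPlus e f) = ival I s e + ival I s f"
| "ival I s (IMinus e f) = ival I s e - ival I s f"

fun rval :: "machine_input \<Rightarrow> state \<Rightarrow> rexp \<Rightarrow> real" where
  "rval I s RZero = 0"
| "rval I s ROne = 1"
| "rval I s (RootCoord e f) = read_root I (ival I s e) (ival I s f)"
| "rval I s (RGet x e f) = rmem s x (ival I s e) (ival I s f)"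
| "rval I s (RPlus a b) = rval I s a + rval I s b"
| "rval I s (RMinus a b) = rval I s a - rval I s b"
| "rval I s (RTimes a b) = rval I s a * rval I s b"
| "rval I s (RDivide a b) = rval I s a / rval I s b"

fun bval :: "machine_input \<Rightarrow> state \<Rightarrow> bexp \<Rightarrow> bool" where
  "bval I s (ILess e f) \<longleftrightarrow> ival I s e < ival I s f"
| "bval I s (RLess a b) \<longleftrightarrow> rval I s a < rval I s b"
| "bval I s (BNot b) \<longleftrightarrow> \<not> bval I s b"
| "bval I s (BAnd b c) \<longleftrightarrow> bval I s b \<and> bval I s c"

fun icost :: "iexp \<Rightarrow> nat" where
  "icost (WordLetter e) = icost e + 1"
| "icost (ElemLetter e) = icost e + 1"
| "icost (IGet x e) = icost e + 1"
| "icost (IPlus e f) = icost e + icost f + 1"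
| "icost (IMinus e f) = icost e + icost f + 1"
| "icost _ = 1"

fun rcost :: "rexp \<Rightarrow> nat" where
  "rcost (RootCoord e f) = icost e + icost f + 1"
| "rcost (RGet x e f) = icost e + icost f + 1"
| "rcost (RPlus a b) = rcost a + rcost b + 1"
| "rcost (RMinus a b) = rcost a + rcost b + 1"
| "rcost (RTimes a b) = rcost a + rcost b + 1"
| "rcost (RDivide a b) = rcost a + rcost b + 1"
| "rcost _ = 1"

fun bcost :: "bexp \<Rightarrow> nat" where
  "bcost (ILess e f) = icost e + icost f + 1"
| "bcost (RLess a b) = rcost a + rcost b + 1"
| "bcost (BNot b) = bcost b + 1"
| "bcost (BAnd b c) = bcost b + bcost c + 1"

text \<open>A working memory cell holds one index or one coordinate.\<close>

datatype cell = ICell name nat | RCell name nat nat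

text \<open>
  \<open>exec I c s t U s'\<close>: on input \<open>I\<close>, the program \<open>c\<close> started in state \<open>s\<close> halts in state \<open>s'\<close> after
  \<open>t\<close> elementary operations, and \<open>U\<close> is the set of working memory cells it has written. Cells
  never written hold 0, so the number of cells in \<open>U\<close> is the working space.
\<close>

inductive exec ::
    "machine_input \<Rightarrow> com \<Rightarrow> state \<Rightarrow> nat \<Rightarrow> cell set \<Rightarrow> state \<Rightarrow> bool" for I where
  Skip: "exec I Skip s 1 {} s"
| ISet: "k = ival I s e \<Longrightarrow>
    exec I (ISet x e f) s (icost e + icost f + 1) {ICell x k}
      (s\<lparr>imem := (imem s)(x := (imem s x)(k := ival I s f))\<rparr>)"
| RSet: "k = ival I s e \<Longrightarrow> l = ival I s f \<Longrightarrow>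
    exec I (RSet x e f a) s (icost e + icost f + rcost a + 1) {RCell x k l}
      (s\<lparr>rmem := (rmem s)(x := (rmem s x)(k := (rmem s x k)(l := rval I s a)))\<rparr>)"
| Emit: "exec I (Emit e) s (icost e + 1) {} (s\<lparr>pending := pending s @ [ival I s e]\<rparr>)"
| EndFacet: "exec I EndFacet s 1 {} (s\<lparr>pending := [], produced := produced s @ [pending s]\<rparr>)"
| Seq: "exec I c s t U s' \<Longrightarrow> exec I d s' t' U' s'' \<Longrightarrow> exec I (Seq c d) s (t + t') (U \<union> U') s''"
| IfTrue: "bval I s b \<Longrightarrow> exec I c s t U s' \<Longrightarrow> exec I (IfElse b c d) s (bcost b + t + 1) U s'"
| IfFalse: "\<not> bval I s b \<Longrightarrow> exec I d s t U s' \<Longrightarrow> exec I (IfElse b c d) s (bcost b + t + 1) U s'"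
| WhileFalse: "\<not> bval I s b \<Longrightarrow> exec I (While b c) s (bcost b + 1) {} s"
| WhileTrue: "bval I s b \<Longrightarrow> exec I c s t U s' \<Longrightarrow> exec I (While b c) s' t' U' s'' \<Longrightarrow>
    exec I (While b c) s (bcost b + t + t' + 1) (U \<union> U') s''"

inductive_cases Skip_elim: "exec I Skip s t U s'"
inductive_cases ISet_elim: "exec I (ISet x e f) s t U s'"
inductive_cases RSet_elim: "exec I (RSet x e f a) s t U s'"
inductive_cases Emit_elim: "exec I (Emit e) s t U s'"
inductive_cases EndFacet_elim: "exec I EndFacet s t U s'"
inductive_cases Seq_elim: "exec I (Seq c d) s t U s'"
inductive_cases IfElse_elim: "exec I (IfElse b c d) s t U s'"
inductive_cases While_elim: "exec I (While b c) s t U s'"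

lemma exec_deterministic:
  "exec I c s t U s' \<Longrightarrow> exec I c s t' U' s'' \<Longrightarrow> t' = t \<and> U' = U \<and> s'' = s'"
proof (induction arbitrary: t' U' s'' rule: exec.induct)
  case (Skip s)
  then show ?case by (auto elim: Skip_elim)
next
  case (ISet k s e x f)
  from ISet.prems show ?case by (rule ISet_elim) (simp add: ISet.hyps)
next
  case (RSet k s e l f x a)
  from RSet.prems show ?case by (rule RSet_elim) (simp add: RSet.hyps)
next
  case (Emit e s)
  from Emit.prems show ?case by (rule Emit_elim) simp
next
  case (EndFacet s)
  from EndFacet.prems show ?case by (rule EndFacet_elim) simp
next
  case (Seq c s t U s' d t1 U1 s1)
  from Seq.prems show ?case by (rule Seq_elim) (auto dest!: Seq.IH)
next
  case (IfTrue s b c t U s' d)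
  from IfTrue.prems show ?case by (rule IfElse_elim) (auto simp: IfTrue.hyps dest!: IfTrue.IH)
next
  case (IfFalse s b d t U s' c)
  from IfFalse.prems show ?case by (rule IfElse_elim) (auto simp: IfFalse.hyps dest!: IfFalse.IH)
next
  case (WhileFalse s b c)
  from WhileFalse.prems show ?case by (rule While_elim) (simp_all add: WhileFalse.hyps)
next
  case (WhileTrue s b c t U s' t1 U1 s1)
  from WhileTrue.prems show ?case
    by (rule While_elim) (auto simp: WhileTrue.hyps dest!: WhileTrue.IH)
qed

end

theory Submission
  imports Defs
begin

text \<open>
  A facet is determined by the set \<open>J\<close> of positions that it does not contain, and these \<open>J\<close> are the
  position sets of reduced expressions of \<open>\<rho>\<close> in \<open>Q\<close>. The program lists them in the lexicographic
  order in which the last position is the most significant and unused comes before used. Only two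
  facts about reflection groups are needed, both read off the roots. First, right multiplication of
  \<open>w\<close> by \<open>s\<^sub>i\<close> shortens \<open>w\<close> exactly when \<open>w\<close> sends the simple root \<open>\<alpha>\<^sub>i\<close> to a negative root. Second,
  in that case \<open>w s\<^sub>i\<close> arises from any word for \<open>w\<close> by deleting one letter (\<open>exchange\<close>).

  The least \<open>J\<close> is found from left to right: a position is used whenever its letter is a left
  descent of the part of \<open>\<rho>\<close> that is still to be expressed
  (\<open>left_greedy_exhausts\<close>). This choice succeeds within every initial segment of
  \<open>Q\<close> that contains a word for \<open>\<rho>\<close> at all; hence it uses no late position
  without need and gives the least \<open>J\<close> (\<open>refill_least\<close>). The successor of
  \<open>J\<close> is found at the first unused position \<open>k\<close> at which the element expressed
  by \<open>J\<close> before \<open>k\<close> has the letter of \<open>k\<close> as a right descent. By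
  exchange some earlier position of \<open>J\<close> can be traded for \<open>k\<close>; this is a flip.
  One marks \<open>k\<close> as used, keeps everything after \<open>k\<close>, and fills the positions
  before \<open>k\<close> greedily again. If there is no such \<open>k\<close>, then \<open>J\<close> is
  the last one (\<open>below_successor_iff\<close>, \<open>last_if_not_flippable\<close>).

  Each descent test applies a word with at most \<open>2m\<close> letters to a simple root. One reflection costs
  \<open>O(n)\<close> operations on standard coordinates. These coordinates do not show the sign of a root, and
  computing coordinates in the basis of simple roots would be too expensive. But all simple root
  coordinates of a root have the same sign, so that their sum, the height, decides; and reflection in
  a simple root subtracts from the height the same multiplier by which the simple root is subtracted
  from the vector. Hence one additional scalar suffices. A facet causes at most \<open>2m\<close> descent tests of
  cost \<open>O(mn)\<close> each, and the memory consists of one bit per position, one vector and a few scalars.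
\<close>

section \<open>Simple roots, heights and words\<close>

locale simple_system =
  fixes n :: nat and \<Phi> :: "real vec set" and \<Delta> :: "real vec list"
  assumes root_system: "root_system n \<Phi>"
    and simple_roots: "simple_roots n \<Phi> \<Delta>"
begin

text \<open>Indices \<open>i \<ge> n\<close> act as the identity, so that facts about words need no side condition on the
  letters. This does not make any group element shorter, since such letters can be dropped.\<close>

definition simple_refl :: "nat \<Rightarrow> real vec \<Rightarrow> real vec" where
  "simple_refl i x = (if i < n then refl_mat n (\<Delta> ! i) *\<^sub>v x else x)"

definition act :: "nat list \<Rightarrow> real vec \<Rightarrow> real vec" where
  "act w = foldr simple_refl w"

definition coords :: "real vec \<Rightarrow> real vec" where
  "coords x = (THE c. c \<in> carrier_vec n \<and> mat_of_cols n \<Delta> *\<^sub>v c = x)"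

definition height :: "real vec \<Rightarrow> real" where
  "height x = (\<Sum>i<n. coords x $ i)"

lemma length_simple: "length \<Delta> = n"
  using simple_roots by (simp add: simple_roots_def)

lemma simple_matrix_carrier: "mat_of_cols n \<Delta> \<in> carrier_mat n n"
  using mat_of_cols_carrier(1)[of n \<Delta>] by (simp only: length_simple)

lemma simple_in_roots: "i < n \<Longrightarrow> \<Delta> ! i \<in> \<Phi>"
  using simple_roots by (auto simp: simple_roots_def)

lemma root_carrier: "\<beta> \<in> \<Phi> \<Longrightarrow> \<beta> \<in> carrier_vec n"
  using root_system by (auto simp: root_system_def)

lemma simple_carrier [simp]: "i < n \<Longrightarrow> \<Delta> ! i \<in> carrier_vec n"
  by (simp add: simple_in_roots root_carrier)

lemma dim_simple [simp]: "i < n \<Longrightarrow> dim_vec (\<Delta> ! i) = n"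
  by (rule carrier_vecD) simp

lemma simple_norm_pos: assumes "i < n" shows "\<Delta> ! i \<bullet> \<Delta> ! i > 0"
proof -
  let ?a = "\<Delta> ! i"
  have a: "?a \<in> carrier_vec n" "?a \<noteq> 0\<^sub>v n"
    using simple_in_roots[OF assms] root_system assms by (auto simp: root_system_def)
  then obtain j where j: "j < n" "?a $ j \<noteq> 0"
    using assms by (metis eq_vecI index_zero_vec carrier_vecD)
  have "0 < (?a $ j)\<^sup>2" using j by simp
  also have "\<dots> \<le> (\<Sum>k\<in>{0..<n}. (?a $ k)\<^sup>2)"
    using j by (intro member_le_sum) auto
  finally show ?thesis
    using assms by (simp add: scalar_prod_def power2_eq_square)
qed

lemma simple_refl_eq:
  assumes "i < n" "x \<in> carrier_vec n"
  shows "simple_refl i x = x - (2 * (\<Delta> ! i \<bullet> x) / (\<Delta> ! i \<bullet> \<Delta> ! i)) \<cdot>\<^sub>v \<Delta> ! i"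
proof (rule eq_vecI)
  let ?a = "\<Delta> ! i" let ?N = "\<Delta> ! i \<bullet> \<Delta> ! i"
  fix j assume "j < dim_vec (x - (2 * (?a \<bullet> x) / ?N) \<cdot>\<^sub>v ?a)"
  then have j: "j < n" using assms by simp
  have "simple_refl i x $ j = (\<Sum>k\<in>{0..<n}. ((if j = k then 1 else 0) - 2 * ?a $ j * ?a $ k / ?N) * x $ k)"
    using assms j by (simp add: simple_refl_def refl_mat_def scalar_prod_def)
  also have "\<dots> = (\<Sum>k\<in>{0..<n}. (if j = k then x $ k else 0) - 2 * ?a $ j / ?N * (?a $ k * x $ k))"
    by (rule sum.cong) (simp_all add: left_diff_distrib)
  also have "\<dots> = x $ j - 2 * ?a $ j / ?N * (?a \<bullet> x)"
    using assms j by (simp only: sum_subtractf sum_distrib_left[symmetric])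
      (simp add: scalar_prod_def)
  finally show "simple_refl i x $ j = (x - (2 * (?a \<bullet> x) / ?N) \<cdot>\<^sub>v ?a) $ j"
    using assms j by (simp add: algebra_simps)
qed (use assms in \<open>simp add: simple_refl_def refl_mat_def\<close>)

lemma simple_refl_carrier [simp]: "x \<in> carrier_vec n \<Longrightarrow> simple_refl i x \<in> carrier_vec n"
  by (auto simp: simple_refl_def refl_mat_def intro: carrier_vecI)

lemma simple_refl_involutive [simp]:
  assumes "x \<in> carrier_vec n" shows "simple_refl i (simple_refl i x) = x"
proof (cases "i < n")
  case True
  let ?a = "\<Delta> ! i" let ?c = "2 * (\<Delta> ! i \<bullet> x) / (\<Delta> ! i \<bullet> \<Delta> ! i)"
  have N: "?a \<bullet> ?a \<noteq> 0" using simple_norm_pos[OF True] by simp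
  have "?a \<bullet> simple_refl i x = - (?a \<bullet> x)"
    using True assms N by (simp add: simple_refl_eq scalar_prod_minus_distrib[where n = n])
  then have "simple_refl i (simple_refl i x) = x - ?c \<cdot>\<^sub>v ?a - (- ?c) \<cdot>\<^sub>v ?a"
    using True assms by (simp add: simple_refl_eq)
  then show ?thesis using True assms by (intro eq_vecI) auto
qed (simp add: simple_refl_def)

lemma simple_refl_root: "\<beta> \<in> \<Phi> \<Longrightarrow> simple_refl i \<beta> \<in> \<Phi>"
  using root_system by (auto simp: simple_refl_def root_system_def simple_in_roots)

text \<open>The combination \<open>x - a y\<close> is the shape in which reflections occur, so this one law
  replaces additivity and homogeneity.\<close>

lemma simple_refl_combine:
  assumes "x \<in> carrier_vec n" "y \<in> carrier_vec n"
  shows "simple_refl i (x - a \<cdot>\<^sub>v y) = simple_refl i x - a \<cdot>\<^sub>v simple_refl i y"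
proof -
  have R: "refl_mat n (\<Delta> ! i) \<in> carrier_mat n n" by (simp add: refl_mat_def)
  show ?thesis
    using assms by (simp add: simple_refl_def mult_minus_distrib_mat_vec[OF R] mult_mat_vec[OF R])
qed

lemma simple_refl_isometry:
  assumes "x \<in> carrier_vec n" "y \<in> carrier_vec n"
  shows "simple_refl i x \<bullet> simple_refl i y = x \<bullet> y"
proof (cases "i < n")
  case True
  let ?a = "\<Delta> ! i"
  have N: "?a \<bullet> ?a \<noteq> 0" using simple_norm_pos[OF True] by simp
  have c: "x \<bullet> ?a = ?a \<bullet> x"
    by (rule comm_scalar_prod[where n = n]) (use assms True in auto)
  show ?thesis
    using assms True N c
    by (simp add: simple_refl_eq scalar_prod_minus_distrib[where n = n] minus_scalar_prod_distrib[where n = n])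
qed (simp add: simple_refl_def)

lemma act_Nil [simp]: "act [] x = x"
  and act_Cons [simp]: "act (i # w) x = simple_refl i (act w x)"
  and act_append [simp]: "act (u @ w) x = act u (act w x)"
  by (simp_all add: act_def)

lemma act_carrier [simp]: "x \<in> carrier_vec n \<Longrightarrow> act w x \<in> carrier_vec n"
  by (induction w) auto

lemma act_root: "\<beta> \<in> \<Phi> \<Longrightarrow> act w \<beta> \<in> \<Phi>"
  by (induction w) (auto simp: simple_refl_root)

lemma act_rev [simp]: "x \<in> carrier_vec n \<Longrightarrow> act (rev w) (act w x) = x"
  by (induction w arbitrary: x) auto

lemma act_rev' [simp]: "x \<in> carrier_vec n \<Longrightarrow> act w (act (rev w) x) = x"
  using act_rev[of x "rev w"] by simp

lemma act_combine:
  "x \<in> carrier_vec n \<Longrightarrow> y \<in> carrier_vec n \<Longrightarrow> act w (x - a \<cdot>\<^sub>v y) = act w x - a \<cdot>\<^sub>v act w y"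
  by (induction w) (auto simp: simple_refl_combine)

lemma act_isometry:
  "x \<in> carrier_vec n \<Longrightarrow> y \<in> carrier_vec n \<Longrightarrow> act w x \<bullet> act w y = x \<bullet> y"
  by (induction w) (auto simp: simple_refl_isometry)

lemma coords:
  assumes "x \<in> carrier_vec n"
  shows "coords x \<in> carrier_vec n" "mat_of_cols n \<Delta> *\<^sub>v coords x = x"
proof -
  have "\<exists>!c. c \<in> carrier_vec n \<and> mat_of_cols n \<Delta> *\<^sub>v c = x"
    using simple_roots assms by (simp add: simple_roots_def)
  from theI'[OF this] show "coords x \<in> carrier_vec n" "mat_of_cols n \<Delta> *\<^sub>v coords x = x"
    by (simp_all add: coords_def)
qed

lemma coords_unique:
  assumes "c \<in> carrier_vec n" "mat_of_cols n \<Delta> *\<^sub>v c = x"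
  shows "coords x = c"
proof -
  have x: "x \<in> carrier_vec n" using assms by (metis dim_mult_mat_vec carrier_vec_dim_vec mat_of_cols_carrier(2))
  then have "\<exists>!c. c \<in> carrier_vec n \<and> mat_of_cols n \<Delta> *\<^sub>v c = x"
    using simple_roots by (simp add: simple_roots_def)
  then show ?thesis using coords[OF x] assms by blast
qed

lemma simple_as_column:
  assumes "i < n" shows "mat_of_cols n \<Delta> *\<^sub>v unit_vec n i = \<Delta> ! i"
  using assms by (intro eq_vecI) (auto simp: length_simple mat_of_cols_index)

lemma coords_simple: "i < n \<Longrightarrow> coords (\<Delta> ! i) = unit_vec n i"
  by (rule coords_unique) (auto simp: simple_as_column)

lemma coords_shift:
  assumes "i < n" "x \<in> carrier_vec n"
  shows "coords (x - a \<cdot>\<^sub>v \<Delta> ! i) = coords x - a \<cdot>\<^sub>v unit_vec n i"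
proof (rule coords_unique)
  note M = simple_matrix_carrier
  show "mat_of_cols n \<Delta> *\<^sub>v (coords x - a \<cdot>\<^sub>v unit_vec n i) = x - a \<cdot>\<^sub>v \<Delta> ! i"
    using assms coords[OF assms(2)]
    by (simp add: mult_minus_distrib_mat_vec[OF M] mult_mat_vec[OF M] simple_as_column)
qed (use assms coords[OF assms(2)] in auto)

lemma height_simple: "i < n \<Longrightarrow> height (\<Delta> ! i) = 1"
  by (simp add: height_def coords_simple)

lemma height_shift:
  assumes "i < n" "x \<in> carrier_vec n"
  shows "height (x - a \<cdot>\<^sub>v \<Delta> ! i) = height x - a"
proof -
  have "height (x - a \<cdot>\<^sub>v \<Delta> ! i) = (\<Sum>k<n. coords x $ k - (if k = i then a else 0))"
    using assms coords[OF assms(2)] by (auto simp: height_def coords_shift intro!: sum.cong)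
  then show ?thesis using assms by (simp add: height_def sum_subtractf)
qed

lemma root_coords_sign:
  assumes "\<beta> \<in> \<Phi>"
  shows "(\<forall>i<n. 0 \<le> coords \<beta> $ i) \<or> (\<forall>i<n. coords \<beta> $ i \<le> 0)"
  using simple_roots assms coords_unique unfolding simple_roots_def by metis

lemma root_coords_nonzero:
  assumes "\<beta> \<in> \<Phi>" shows "\<exists>i<n. coords \<beta> $ i \<noteq> 0"
proof (rule ccontr)
  note M = simple_matrix_carrier
  note c = coords[OF root_carrier[OF assms]]
  assume "\<not> ?thesis"
  then have "coords \<beta> = 0\<^sub>v n" using c by (intro eq_vecI) auto
  then have "\<beta> = 0\<^sub>v n" using c(2) M by (intro eq_vecI) (auto simp: scalar_prod_def)
  then show False using assms root_system by (simp add: root_system_def)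
qed

text \<open>All coordinates of a root have the same sign, so a single number decides it: their sum.\<close>

lemma root_height_pos:
  assumes "\<beta> \<in> \<Phi>" "j < n" "coords \<beta> $ j > 0" shows "height \<beta> > 0"
proof -
  have nn: "\<forall>i<n. 0 \<le> coords \<beta> $ i"
    using root_coords_sign[OF assms(1)] assms by fastforce
  then have "coords \<beta> $ j \<le> height \<beta>"
    unfolding height_def using assms by (intro member_le_sum) auto
  then show ?thesis using assms by simp
qed

lemma root_height_nonneg_coords:
  assumes "\<beta> \<in> \<Phi>" "height \<beta> \<ge> 0" "i < n" shows "coords \<beta> $ i \<ge> 0"
proof (rule ccontr)
  assume negative: "\<not> ?thesis"
  then have np: "\<forall>i<n. coords \<beta> $ i \<le> 0"
    using root_coords_sign[OF assms(1)] assms by fastforce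
  have "- coords \<beta> $ i \<le> (\<Sum>k<n. - coords \<beta> $ k)"
    using np assms by (intro member_le_sum) auto
  then show False using negative assms by (simp add: height_def sum_negf)
qed

lemma root_height_nonzero: assumes "\<beta> \<in> \<Phi>" shows "height \<beta> \<noteq> 0"
proof
  assume z: "height \<beta> = 0"
  obtain j where j: "j < n" "coords \<beta> $ j \<noteq> 0" using root_coords_nonzero[OF assms] by blast
  then have "coords \<beta> $ j > 0"
    using root_height_nonneg_coords[OF assms] z by (metis less_eq_real_def order.refl)
  then show False using root_height_pos[OF assms] j z by force
qed

text \<open>A simple reflection changes only one coordinate, so a positive root with another nonzero
  coordinate stays positive.\<close>

lemma positive_root_sent_to_negative:
  assumes \<beta>: "\<beta> \<in> \<Phi>" "height \<beta> > 0" and i: "i < n" and negative: "height (simple_refl i \<beta>) < 0"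
  shows "\<beta> = \<Delta> ! i"
proof -
  note \<beta>c = root_carrier[OF \<beta>(1)]
  note c = coords[OF \<beta>c]
  have other: "coords \<beta> $ j = 0" if "j < n" "j \<noteq> i" for j
  proof (rule ccontr)
    assume "coords \<beta> $ j \<noteq> 0"
    then have "coords \<beta> $ j > 0" using root_height_nonneg_coords[OF \<beta>(1)] \<beta>(2) that by fastforce
    then have "coords (simple_refl i \<beta>) $ j > 0"
      using that c i by (simp add: simple_refl_eq[OF i \<beta>c] coords_shift[OF i \<beta>c])
    then show False using root_height_pos[OF simple_refl_root[OF \<beta>(1)]] that negative by fastforce
  qed
  note M = simple_matrix_carrier
  have "coords \<beta> = (coords \<beta> $ i) \<cdot>\<^sub>v unit_vec n i"
    using c i other by (intro eq_vecI) auto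
  then have "\<beta> = (coords \<beta> $ i) \<cdot>\<^sub>v \<Delta> ! i"
    using c(2) simple_as_column[OF i] mult_mat_vec[OF M unit_vec_carrier] by metis
  then have "\<beta> \<in> {\<beta> \<in> \<Phi>. \<exists>c. \<beta> = c \<cdot>\<^sub>v \<Delta> ! i}" using \<beta> by blast
  then have "\<beta> = \<Delta> ! i \<or> \<beta> = - \<Delta> ! i"
    using root_system simple_in_roots[OF i] by (auto simp: root_system_def)
  moreover have "\<beta> \<noteq> - \<Delta> ! i"
  proof
    assume "\<beta> = - \<Delta> ! i"
    also have "\<dots> = \<Delta> ! i - 2 \<cdot>\<^sub>v \<Delta> ! i" using i by (intro eq_vecI) auto
    finally have "height \<beta> = -1" using height_shift[OF i, of "\<Delta> ! i" 2] height_simple[OF i] i by simp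
    then show False using \<beta> by simp
  qed
  ultimately show ?thesis by blast
qed

section \<open>Equivalent words, the exchange property and descents\<close>

text \<open>Equality as group elements; \<open>elem_eq_iff\<close> relates it to products of matrices.\<close>

definition weq :: "nat list \<Rightarrow> nat list \<Rightarrow> bool" (infix "\<approx>" 50) where
  "u \<approx> v \<longleftrightarrow> (\<forall>x\<in>carrier_vec n. act u x = act v x)"

text \<open>The condition on roots that means that \<open>i\<close> is a right descent of \<open>w\<close>;
  \<open>reduced_snoc_iff\<close> gives the meaning in terms of length.\<close>

definition descent :: "nat list \<Rightarrow> nat \<Rightarrow> bool" where
  "descent w i \<longleftrightarrow> height (act w (\<Delta> ! i)) < 0"

definition reduced :: "nat list \<Rightarrow> bool" where
  "reduced w \<longleftrightarrow> (\<forall>u. u \<approx> w \<longrightarrow> length w \<le> length u)"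

lemma weq_refl [simp]: "w \<approx> w" by (simp add: weq_def)

lemma weq_sym: "u \<approx> v \<Longrightarrow> v \<approx> u" by (simp add: weq_def)

lemma weq_trans [trans]: "u \<approx> v \<Longrightarrow> v \<approx> w \<Longrightarrow> u \<approx> w" by (simp add: weq_def)

lemma weq_append: "u \<approx> u' \<Longrightarrow> v \<approx> v' \<Longrightarrow> u @ v \<approx> u' @ v'" by (simp add: weq_def)

lemma weq_rev: assumes "u \<approx> v" shows "rev u \<approx> rev v"
  unfolding weq_def
proof
  fix x :: "real vec" assume x: "x \<in> carrier_vec n"
  have "act (rev u) x = act (rev u) (act v (act (rev v) x))" using x by simp
  also have "\<dots> = act (rev u) (act u (act (rev v) x))" using x assms by (simp add: weq_def)
  also have "\<dots> = act (rev v) x" using x by simp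
  finally show "act (rev u) x = act (rev v) x" .
qed

lemma weq_move_left: "u @ v \<approx> w \<longleftrightarrow> v \<approx> rev u @ w"
proof
  assume "u @ v \<approx> w"
  then have "rev u @ (u @ v) \<approx> rev u @ w" by (intro weq_append) auto
  then show "v \<approx> rev u @ w" by (simp add: weq_def)
next
  assume "v \<approx> rev u @ w"
  then have "u @ v \<approx> u @ (rev u @ w)" by (intro weq_append) auto
  then show "u @ v \<approx> w" by (simp add: weq_def)
qed

lemma weq_move_right: "u @ v \<approx> w \<longleftrightarrow> u \<approx> w @ rev v"
proof
  assume "u @ v \<approx> w"
  then have "(u @ v) @ rev v \<approx> w @ rev v" by (intro weq_append) auto
  then show "u \<approx> w @ rev v" by (simp add: weq_def)
next
  assume "u \<approx> w @ rev v"
  then have "u @ v \<approx> (w @ rev v) @ v" by (intro weq_append) auto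
  then show "u @ v \<approx> w" by (simp add: weq_def)
qed

lemma weq_cancel2: "w @ [i, i] \<approx> w" by (simp add: weq_def)

lemma descent_cong: "u \<approx> v \<Longrightarrow> i < n \<Longrightarrow> descent u i \<longleftrightarrow> descent v i"
  by (simp add: descent_def weq_def)

text \<open>Since \<open>s\<^sub>i\<close> negates \<open>\<alpha>\<^sub>i\<close>, the images of \<open>\<alpha>\<^sub>i\<close> under \<open>w\<close> and \<open>w s\<^sub>i\<close> are opposite roots.\<close>

lemma descent_snoc: assumes "i < n" shows "descent (w @ [i]) i \<longleftrightarrow> \<not> descent w i"
proof -
  let ?b = "act w (\<Delta> ! i)"
  have N: "\<Delta> ! i \<bullet> \<Delta> ! i \<noteq> 0" using simple_norm_pos[OF assms] by simp
  have "simple_refl i (\<Delta> ! i) = 0\<^sub>v n - 1 \<cdot>\<^sub>v \<Delta> ! i"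
    using assms N by (simp add: simple_refl_eq) (intro eq_vecI; simp)
  then have e: "act (w @ [i]) (\<Delta> ! i) = act w (0\<^sub>v n) - 1 \<cdot>\<^sub>v ?b"
    using assms act_combine[of "0\<^sub>v n" "\<Delta> ! i" w 1] by simp
  have z: "act w (0\<^sub>v n) = 0\<^sub>v n"
    using act_combine[of "0\<^sub>v n" "0\<^sub>v n" w 1] act_carrier[of "0\<^sub>v n" w]
    by (metis minus_cancel_vec one_smult_vec zero_carrier_vec)
  note M = simple_matrix_carrier
  note b = coords[OF act_carrier[OF simple_carrier[OF assms]], of w]
  have bc: "?b \<in> carrier_vec n" using assms by simp
  have "coords (0\<^sub>v n - 1 \<cdot>\<^sub>v ?b) = 0\<^sub>v n - 1 \<cdot>\<^sub>v coords ?b"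
  proof (rule coords_unique)
    have "mat_of_cols n \<Delta> *\<^sub>v 0\<^sub>v n = 0\<^sub>v n" using M by (intro eq_vecI) (auto simp: scalar_prod_def)
    moreover have "mat_of_cols n \<Delta> *\<^sub>v (1 \<cdot>\<^sub>v coords ?b) = 1 \<cdot>\<^sub>v ?b"
      using mult_mat_vec[OF M b(1), of 1] b(2) by simp
    moreover have "mat_of_cols n \<Delta> *\<^sub>v (0\<^sub>v n - 1 \<cdot>\<^sub>v coords ?b)
        = mat_of_cols n \<Delta> *\<^sub>v 0\<^sub>v n - mat_of_cols n \<Delta> *\<^sub>v (1 \<cdot>\<^sub>v coords ?b)"
      by (rule mult_minus_distrib_mat_vec[OF M]) (use b in auto)
    ultimately show "mat_of_cols n \<Delta> *\<^sub>v (0\<^sub>v n - 1 \<cdot>\<^sub>v coords ?b) = 0\<^sub>v n - 1 \<cdot>\<^sub>v ?b"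
      by simp
  qed (use b in auto)
  then have "height (act (w @ [i]) (\<Delta> ! i)) = - height ?b"
    using b(1) unfolding e z by (simp add: height_def sum_negf)
  moreover have "height ?b \<noteq> 0" using root_height_nonzero act_root simple_in_roots assms by blast
  ultimately show ?thesis by (auto simp: descent_def)
qed

text \<open>While the letters of \<open>w\<close> are applied to the positive root \<open>\<alpha>\<^sub>i\<close> from the right, the sign must
  change at some letter \<open>j\<close>. Just before it the root is \<open>\<alpha>\<^sub>j\<close>, so the word \<open>v\<close> to the right of \<open>j\<close>
  conjugates \<open>s\<^sub>i\<close> into \<open>s\<^sub>j\<close>, that is, \<open>j v i\<close> and \<open>v\<close> are equivalent.\<close>

lemma exchange:
  assumes "descent w i" "i < n"
  shows "\<exists>u j v. w = u @ j # v \<and> w @ [i] \<approx> u @ v"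
  using assms(1)
proof (induction w)
  case Nil
  then show ?case using assms by (simp add: descent_def height_simple)
next
  case (Cons j w)
  let ?b = "act w (\<Delta> ! i)"
  have b: "?b \<in> \<Phi>" using act_root simple_in_roots assms by blast
  show ?case
  proof (cases "descent w i")
    case True
    from Cons.IH[OF this] obtain u k v where "w = u @ k # v" "w @ [i] \<approx> u @ v" by blast
    then have "j # w = (j # u) @ k # v" "(j # w) @ [i] \<approx> (j # u) @ v"
      by (auto simp: weq_def)
    then show ?thesis by blast
  next
    case False
    then have pos: "height ?b > 0" using root_height_nonzero[OF b] by (simp add: descent_def)
    have negative: "height (simple_refl j ?b) < 0" using Cons.prems by (simp add: descent_def)
    have j: "j < n" using pos negative by (cases "j < n") (auto simp: simple_refl_def)
    have bj: "?b = \<Delta> ! j" by (rule positive_root_sent_to_negative[OF b pos j negative])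
    have "act w (simple_refl i x) = simple_refl j (act w x)" if x: "x \<in> carrier_vec n" for x
    proof -
      have "\<Delta> ! j \<bullet> act w x = \<Delta> ! i \<bullet> x" "\<Delta> ! j \<bullet> \<Delta> ! j = \<Delta> ! i \<bullet> \<Delta> ! i"
        using act_isometry[of "\<Delta> ! i" _ w] x assms unfolding bj[symmetric] by auto
      then show ?thesis
        using x assms j by (simp add: simple_refl_eq act_combine bj)
    qed
    then have "(j # w) @ [i] \<approx> [] @ w" by (simp add: weq_def)
    then show ?thesis by blast
  qed
qed

lemma reduced_cong: "u \<approx> v \<Longrightarrow> length u = length v \<Longrightarrow> reduced u \<Longrightarrow> reduced v"
  unfolding reduced_def by (metis weq_sym weq_trans)

lemma reduced_rev: assumes "reduced w" shows "reduced (rev w)"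
  unfolding reduced_def
proof (intro allI impI)
  fix u assume "u \<approx> rev w"
  then have "rev u \<approx> w" using weq_rev by fastforce
  then show "length (rev w) \<le> length u" using assms unfolding reduced_def by fastforce
qed

lemma reduced_factor: assumes "reduced (x @ y @ z)" shows "reduced y"
  unfolding reduced_def
proof (intro allI impI)
  fix u assume "u \<approx> y"
  then have "x @ u @ z \<approx> x @ y @ z" by (intro weq_append) auto
  then show "length y \<le> length u" using assms unfolding reduced_def by fastforce
qed

lemma reduced_snoc_iff:
  assumes "i < n" "reduced w" shows "reduced (w @ [i]) \<longleftrightarrow> \<not> descent w i"
proof
  assume red: "reduced (w @ [i])"
  show "\<not> descent w i"
  proof
    assume "descent w i"
    then obtain u j v where uv: "w = u @ j # v" "w @ [i] \<approx> u @ v" using exchange assms by blast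
    then have "length (w @ [i]) \<le> length (u @ v)"
      using red weq_sym[OF uv(2)] unfolding reduced_def by blast
    then show False using uv(1) by simp
  qed
next
  assume pos: "\<not> descent w i"
  show "reduced (w @ [i])"
    unfolding reduced_def
  proof (intro allI impI)
    fix u assume u: "u \<approx> w @ [i]"
    then have "descent u i" using descent_snoc[OF assms(1)] descent_cong assms pos by blast
    then obtain u1 j u2 where s: "u = u1 @ j # u2" "u @ [i] \<approx> u1 @ u2" using exchange assms by blast
    have "u @ [i] \<approx> (w @ [i]) @ [i]" using u by (intro weq_append) auto
    then have "u1 @ u2 \<approx> w"
      using s(2) weq_cancel2[of w i] by (simp) (meson weq_sym weq_trans)
    then show "length (w @ [i]) \<le> length u" using assms(2) s(1) unfolding reduced_def by fastforce
  qed
qed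

lemma reduced_snoc_descent: "i < n \<Longrightarrow> reduced (w @ [i]) \<Longrightarrow> descent (w @ [i]) i"
  using reduced_snoc_iff descent_snoc reduced_factor[of "[]" w "[i]"] by simp

text \<open>A shortening of \<open>w\<close> by \<open>s\<^sub>i\<close> is inherited by every reduced word that ends in \<open>w\<close>.\<close>

lemma descent_extend_left:
  assumes "reduced (z @ w)" "i < n" "descent w i" shows "descent (z @ w) i"
proof (rule ccontr)
  assume "\<not> descent (z @ w) i"
  then have "reduced (z @ (w @ [i]) @ [])" using reduced_snoc_iff[OF assms(2,1)] by simp
  then have "reduced (w @ [i])" by (rule reduced_factor)
  moreover have "reduced w" using assms(1) reduced_factor[of z w "[]"] by simp
  ultimately show False using reduced_snoc_iff assms by blast
qed

end

section \<open>Sets of positions expressing the element\<close>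

locale subword_problem = simple_system +
  fixes Q r :: "nat list"
  assumes Q_letters: "set Q \<subseteq> {..<n}" and r_letters: "set r \<subseteq> {..<n}" and r_reduced: "reduced r"
begin

abbreviation m :: nat where "m \<equiv> length Q"

definition used_word :: "nat set \<Rightarrow> nat \<Rightarrow> nat \<Rightarrow> nat list" where
  "used_word J a b = map ((!) Q) (filter (\<lambda>p. p \<in> J) [a..<b])"

definition expresses :: "nat set \<Rightarrow> bool" where
  "expresses J \<longleftrightarrow> J \<subseteq> {..<m} \<and> used_word J 0 m \<approx> r \<and> length (used_word J 0 m) = length r"

text \<open>The lexicographic order on position sets in which the largest position is the most
  significant.\<close>

definition below :: "nat set \<Rightarrow> nat set \<Rightarrow> bool" (infix "\<sqsubset>" 50) where
  "J \<sqsubset> J' \<longleftrightarrow> (\<exists>p. p \<notin> J \<and> p \<in> J' \<and> (\<forall>i>p. i \<in> J \<longleftrightarrow> i \<in> J'))"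

text \<open>The word \<open>T\<close> expresses the inverse of the element to be expressed before position \<open>k\<close>. Then
  \<open>T\<close> followed by the word of \<open>J\<close> before \<open>p\<close> expresses the inverse of what remains at \<open>p\<close>, and
  its right descents are the left descents of the remainder.\<close>

definition left_greedy :: "nat list \<Rightarrow> nat set \<Rightarrow> nat \<Rightarrow> bool" where
  "left_greedy T J k \<longleftrightarrow> (\<forall>p<k. p \<in> J \<longleftrightarrow> descent (T @ used_word J 0 p) (Q ! p))"

lemma letter_less [simp]: "p < m \<Longrightarrow> Q ! p < n"
  using Q_letters nth_mem by blast

lemma used_word_split: "a \<le> b \<Longrightarrow> b \<le> c \<Longrightarrow> used_word J a c = used_word J a b @ used_word J b c"
  using upt_add_eq_append[of a b "c - b"] by (simp add: used_word_def)

lemma used_word_same [simp]: "used_word J a a = []"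
  by (simp add: used_word_def)

lemma used_word_Suc: "a \<le> p \<Longrightarrow> used_word J a (Suc p) = used_word J a p @ (if p \<in> J then [Q ! p] else [])"
  by (simp add: used_word_def)

lemma used_word_first: "p < b \<Longrightarrow> used_word J p b = (if p \<in> J then [Q ! p] else []) @ used_word J (Suc p) b"
  by (simp add: used_word_def upt_conv_Cons)

lemma used_word_cong: "(\<And>i. a \<le> i \<Longrightarrow> i < b \<Longrightarrow> i \<in> J \<longleftrightarrow> i \<in> J') \<Longrightarrow> used_word J a b = used_word J' a b"
  by (auto simp: used_word_def intro!: arg_cong[where f = "map ((!) Q)"] filter_cong)

lemma length_used_word: "J \<subseteq> {..<m} \<Longrightarrow> length (used_word J 0 m) = card J"
proof -
  assume J: "J \<subseteq> {..<m}"
  have "set (filter (\<lambda>p. p \<in> J) [0..<m]) = J" using J by auto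
  then show ?thesis using distinct_card[of "filter (\<lambda>p. p \<in> J) [0..<m]"] by (simp add: used_word_def)
qed

lemma used_word_delete:
  assumes "used_word J a b = u @ j # v"
  shows "\<exists>t. a \<le> t \<and> t < b \<and> t \<in> J \<and> used_word (J - {t}) a b = u @ v"
proof -
  let ?f = "filter (\<lambda>p. p \<in> J) [a..<b]"
  obtain u' t v' where f: "?f = u' @ t # v'" "map ((!) Q) u' = u" "map ((!) Q) v' = v"
    using assms unfolding used_word_def by (auto simp: map_eq_append_conv map_eq_Cons_conv)
  have "distinct ?f" by simp
  then have t: "t \<notin> set u'" "t \<notin> set v'" unfolding f(1) by auto
  have "filter (\<lambda>p. p \<in> J - {t}) [a..<b] = filter (\<lambda>p. p \<noteq> t) ?f"
    by (simp add: conj_commute)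
  also have "\<dots> = u' @ v'" unfolding f(1) using t by (auto intro!: arg_cong2[where f = append] filter_True)
  finally have "used_word (J - {t}) a b = u @ v" using f by (simp add: used_word_def)
  moreover have "t \<in> set ?f" unfolding f(1) by simp
  ultimately show ?thesis by auto
qed

lemma below_irrefl: "\<not> J \<sqsubset> J" by (auto simp: below_def)

lemma below_asym: "J \<sqsubset> J' \<Longrightarrow> \<not> J' \<sqsubset> J"
  unfolding below_def by (metis linorder_neqE_nat)

lemma below_trans:
  assumes "J1 \<sqsubset> J2" "J2 \<sqsubset> J3" shows "J1 \<sqsubset> J3"
proof -
  obtain p where p: "p \<notin> J1" "p \<in> J2" "\<forall>i>p. i \<in> J1 \<longleftrightarrow> i \<in> J2" using assms by (auto simp: below_def)
  obtain q where q: "q \<notin> J2" "q \<in> J3" "\<forall>i>q. i \<in> J2 \<longleftrightarrow> i \<in> J3" using assms by (auto simp: below_def)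
  show ?thesis
    unfolding below_def
    by (rule exI[of _ "max p q"]) (use p q in \<open>cases p q rule: linorder_cases; auto simp: max_def\<close>)
qed

lemma below_total:
  assumes "J \<subseteq> {..<m}" "J' \<subseteq> {..<m}" "J \<noteq> J'" shows "J \<sqsubset> J' \<or> J' \<sqsubset> J"
proof -
  let ?D = "(J - J') \<union> (J' - J)"
  have D: "finite ?D" "?D \<noteq> {}" using assms by (auto intro: finite_subset)
  have "Max ?D \<in> ?D" using Max_in[OF D] .
  moreover have "i \<notin> ?D" if "i > Max ?D" for i using Max_ge[OF D(1), of i] that by force
  ultimately show ?thesis unfolding below_def by blast
qed

lemma expresses_reduced: "expresses J \<Longrightarrow> reduced (used_word J 0 m)"
  unfolding expresses_def using r_reduced reduced_cong weq_sym by metis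

lemma expresses_reduced_part:
  assumes "expresses J" "a \<le> b" "b \<le> m" shows "reduced (used_word J a b)"
proof -
  have "used_word J 0 m = used_word J 0 a @ used_word J a b @ used_word J b m"
    using assms used_word_split[of 0 a m J] used_word_split[of a b m J] by simp
  then show ?thesis using expresses_reduced[OF assms(1)] reduced_factor by metis
qed

text \<open>The set \<open>C\<close> is transformed into \<open>G\<close> from left to right. Where \<open>C\<close> skips a position that the
  greedy choice takes, exchange trades a later position of \<open>C\<close> for it. The converse does not occur:
  the first letter of a reduced remainder is a left descent of it.\<close>

lemma left_greedy_exhausts:
  assumes k: "k \<le> m" and G: "left_greedy T G k"
    and C: "T @ used_word C 0 k \<approx> []" "reduced (used_word C 0 k)"
  shows "T @ used_word G 0 k \<approx> [] \<and> length (used_word G 0 k) = length (used_word C 0 k)"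
proof -
  have "\<exists>C'. (\<forall>i<p. i \<in> C' \<longleftrightarrow> i \<in> G) \<and> T @ used_word C' 0 k \<approx> [] \<and> length (used_word C' 0 k) = length (used_word C 0 k)"
    if "p \<le> k" for p
    using that
  proof (induction p)
    case 0
    then show ?case using C by auto
  next
    case (Suc p)
    then obtain C' where C': "\<forall>i<p. i \<in> C' \<longleftrightarrow> i \<in> G" "T @ used_word C' 0 k \<approx> []"
      "length (used_word C' 0 k) = length (used_word C 0 k)" by auto
    have p: "p < k" "p < m" using Suc.prems k by auto
    let ?q = "Q ! p" let ?x = "used_word G 0 p" let ?y = "used_word C' p k"
    have x: "used_word C' 0 p = ?x" using C'(1) by (intro used_word_cong) auto
    have xy: "used_word C' 0 k = ?x @ ?y" using used_word_split[of 0 p k C'] p x by simp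
    have "used_word C 0 k \<approx> rev T @ []" "used_word C' 0 k \<approx> rev T @ []"
      using C(1) C'(2) by (simp_all only: weq_move_left)
    then have "used_word C 0 k \<approx> used_word C' 0 k" by (rule weq_trans[OF _ weq_sym])
    then have "reduced (?x @ ?y)" using reduced_cong C(2) C'(3) xy by metis
    then have red: "reduced ?y" using reduced_factor[of ?x ?y "[]"] by simp
    have Tx: "T @ ?x \<approx> rev ?y" using C'(2) xy weq_move_right[of "T @ ?x" ?y "[]"] by simp
    have G_p: "p \<in> G \<longleftrightarrow> descent (rev ?y) ?q"
      using G p descent_cong[OF Tx] by (simp add: left_greedy_def)
    consider (same) "p \<in> C' \<longleftrightarrow> p \<in> G" | (skip) "p \<in> C'" "p \<notin> G" | (trade) "p \<notin> C'" "p \<in> G" by blast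
    then show ?case
    proof cases
      case same
      then have "\<forall>i<Suc p. i \<in> C' \<longleftrightarrow> i \<in> G" using C'(1) less_Suc_eq by auto
      then show ?thesis using C' by blast
    next
      case skip
      then have "rev ?y = rev (used_word C' (Suc p) k) @ [?q]" using used_word_first p by simp
      then have "descent (rev ?y) ?q" using reduced_snoc_descent reduced_rev[OF red] p by simp
      then show ?thesis using G_p skip by simp
    next
      case trade
      then obtain u j v where uv: "rev ?y = u @ j # v" "rev ?y @ [?q] \<approx> u @ v"
        using exchange G_p p by (meson letter_less)
      have "?y = rev v @ j # rev u" using arg_cong[OF uv(1), of rev] by simp
      from used_word_delete[OF this] obtain t where t: "p \<le> t" "t < k" "t \<in> C'"
        "used_word (C' - {t}) p k = rev v @ rev u" by blast
      have tp: "p < t" using t trade by (metis le_neq_implies_less)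
      let ?C = "insert p (C' - {t})"
      have "used_word (C' - {t}) p k = used_word (C' - {t}) (Suc p) k" using used_word_first p trade by simp
      also have "\<dots> = used_word ?C (Suc p) k" by (rule used_word_cong) auto
      finally have "used_word ?C p k = ?q # rev v @ rev u" using t(4) p used_word_first[of p k ?C] by simp
      moreover have "used_word ?C 0 p = ?x" using x tp by (subst x[symmetric], intro used_word_cong) auto
      ultimately have C2: "used_word ?C 0 k = ?x @ ?q # rev v @ rev u"
        using used_word_split[of 0 p k ?C] p by simp
      have "(T @ ?x) @ [?q] \<approx> rev ?y @ [?q]" using Tx by (intro weq_append) auto
      also have "\<dots> \<approx> u @ v" by (rule uv(2))
      finally have "((T @ ?x) @ [?q]) @ rev (u @ v) \<approx> []"
        by (subst weq_move_right) simp
      then have "T @ used_word ?C 0 k \<approx> []" using C2 by simp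
      moreover have "length (used_word ?C 0 k) = length (used_word C 0 k)"
        using C2 C'(3) xy arg_cong[OF uv(1), of length] by simp
      moreover have "\<forall>i<Suc p. i \<in> ?C \<longleftrightarrow> i \<in> G" using C'(1) trade tp less_Suc_eq by auto
      ultimately show ?thesis by blast
    qed
  qed
  from this[of k] obtain C' where "\<forall>i<k. i \<in> C' \<longleftrightarrow> i \<in> G" "T @ used_word C' 0 k \<approx> []"
    "length (used_word C' 0 k) = length (used_word C 0 k)" by auto
  moreover from this have "used_word C' 0 k = used_word G 0 k" by (intro used_word_cong) auto
  ultimately show ?thesis by simp
qed

text \<open>Cyclic rotation of the relation \<open>x y = \<rho>\<close> gives the word \<open>y (rev r)\<close> for the inverse of the
  prefix \<open>x\<close>. It contains only the positions from \<open>k\<close> on, which the refilling does not touch.\<close>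

lemma expresses_cycle:
  assumes "k \<le> m" shows "used_word J 0 m \<approx> r \<longleftrightarrow> (used_word J k m @ rev r) @ used_word J 0 k \<approx> []"
proof -
  have "used_word J 0 m \<approx> r \<longleftrightarrow> used_word J k m \<approx> rev (used_word J 0 k) @ r"
    using assms used_word_split[of 0 k m J] weq_move_left[of "used_word J 0 k" "used_word J k m" r] by simp
  also have "\<dots> \<longleftrightarrow> used_word J k m @ rev r \<approx> rev (used_word J 0 k)"
    using weq_move_right[of "used_word J k m" "rev r" "rev (used_word J 0 k)"] by simp
  also have "\<dots> \<longleftrightarrow> (used_word J k m @ rev r) @ used_word J 0 k \<approx> []"
    using weq_move_right[of "used_word J k m @ rev r" "used_word J 0 k" "[]"] by simp
  finally show ?thesis .
qed

text \<open>The set \<open>C\<close> shows that the first \<open>k\<close> positions contain a word for what is to be expressed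
  before \<open>k\<close>, so the greedy choice succeeds.\<close>

lemma refill_expresses:
  assumes C: "expresses C" and k: "k \<le> m" and G: "G \<subseteq> {..<m}" "\<forall>i\<ge>k. i \<in> G \<longleftrightarrow> i \<in> C"
    and greedy: "left_greedy (used_word G k m @ rev r) G k"
  shows "expresses G"
proof -
  have s: "used_word G k m = used_word C k m" using G by (intro used_word_cong) auto
  have "(used_word G k m @ rev r) @ used_word C 0 k \<approx> []"
    using C expresses_cycle[OF k, of C] s by (simp add: expresses_def)
  from left_greedy_exhausts[OF k greedy this] have
    "(used_word G k m @ rev r) @ used_word G 0 k \<approx> []" "length (used_word G 0 k) = length (used_word C 0 k)"
    using expresses_reduced_part[OF C, of 0 k] k by auto
  then show ?thesis
    using C G expresses_cycle[OF k, of G] s used_word_split[of 0 k m] k by (simp add: expresses_def)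
qed

text \<open>A smaller set \<open>C\<close> would express, before some position \<open>p\<close> of \<open>G\<close>, the same element as \<open>G\<close> does
  up to and including \<open>p\<close>. But then the greedy choice would have succeeded before \<open>p\<close>.\<close>

lemma refill_least:
  assumes G: "expresses G" and k: "k \<le> m" and greedy: "left_greedy (used_word G k m @ rev r) G k"
    and C: "expresses C" "\<forall>i\<ge>k. i \<in> C \<longleftrightarrow> i \<in> G"
  shows "\<not> C \<sqsubset> G"
proof
  assume "C \<sqsubset> G"
  then obtain p where p: "p \<notin> C" "p \<in> G" "\<forall>i>p. i \<in> C \<longleftrightarrow> i \<in> G" by (auto simp: below_def)
  have pk: "p < k" "p < m" using p C(2) G by (force simp: not_less[symmetric] expresses_def)+
  \<comment> \<open>\<open>G\<close> is also the greedy choice for the element that it expresses up to and including \<open>p\<close>\<close>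
  let ?x = "used_word G 0 (Suc p)"
  have cyc: "(used_word G k m @ rev r) @ used_word G 0 k \<approx> []"
    using G expresses_cycle[OF k] by (simp add: expresses_def)
  have "left_greedy (rev ?x) G p"
    unfolding left_greedy_def
  proof (intro allI impI)
    fix i assume i: "i < p"
    let ?y = "used_word G i (Suc p)" let ?z = "used_word G (Suc p) k"
    have yz: "used_word G i k = ?y @ ?z" using used_word_split[of i "Suc p" k G] i pk by simp
    have s: "used_word G 0 k = used_word G 0 i @ used_word G i k" using used_word_split[of 0 i k G] i pk by simp
    have "(used_word G k m @ rev r) @ used_word G 0 i \<approx> rev ?z @ rev ?y"
      using cyc weq_move_right[of "(used_word G k m @ rev r) @ used_word G 0 i" "used_word G i k" "[]"]
      by (simp add: s yz)
    then have 1: "i \<in> G \<longleftrightarrow> descent (rev ?z @ rev ?y) (Q ! i)"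
      using greedy i pk descent_cong by (simp add: left_greedy_def)
    have red: "reduced (rev ?z @ rev ?y)" "reduced (rev ?y)"
      using reduced_rev[OF expresses_reduced_part[OF G]] yz i pk k
      by (metis less_imp_le_nat order.strict_trans rev_append) (use reduced_rev[OF expresses_reduced_part[OF G]] i pk in simp)
    have "i \<in> G \<longleftrightarrow> descent (rev ?y) (Q ! i)"
    proof
      assume "i \<in> G"
      then have "rev ?y = rev (used_word G (Suc i) (Suc p)) @ [Q ! i]" using used_word_first i by simp
      then show "descent (rev ?y) (Q ! i)" using reduced_snoc_descent red(2) i pk by simp
    next
      assume "descent (rev ?y) (Q ! i)"
      then show "i \<in> G" using 1 descent_extend_left red(1) i pk by simp
    qed
    moreover have "rev ?x @ used_word G 0 i \<approx> rev ?y"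
      using used_word_split[of 0 i "Suc p" G] i by (simp add: weq_def)
    ultimately show "i \<in> G \<longleftrightarrow> descent (rev ?x @ used_word G 0 i) (Q ! i)" using descent_cong i pk by simp
  qed
  \<comment> \<open>\<open>C\<close> reaches this element without \<open>p\<close>\<close>
  moreover have "rev ?x @ used_word C 0 p \<approx> []"
  proof -
    have s: "used_word C (Suc p) m = used_word G (Suc p) m" using p by (intro used_word_cong) auto
    have "used_word C 0 (Suc p) @ used_word C (Suc p) m \<approx> r" "?x @ used_word G (Suc p) m \<approx> r"
      using C G pk used_word_split[of 0 "Suc p" m] by (auto simp: expresses_def)
    then have "used_word C 0 (Suc p) \<approx> ?x"
      unfolding s using weq_move_right weq_sym weq_trans by meson
    then show ?thesis
      using weq_move_left[of ?x "[]" "used_word C 0 p"] weq_sym used_word_Suc[of 0 p C] p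
      by (auto simp: weq_move_left[of "rev ?x"])
  qed
  ultimately have "length (used_word G 0 p) = length (used_word C 0 p)"
    using left_greedy_exhausts expresses_reduced_part[OF C(1)] pk by auto
  moreover have "length (used_word C 0 (Suc p)) = length ?x"
  proof -
    have s: "used_word C (Suc p) m = used_word G (Suc p) m" using p by (intro used_word_cong) auto
    have "length (used_word C 0 m) = length (used_word G 0 m)" using C G by (simp add: expresses_def)
    then show ?thesis using used_word_split[of 0 "Suc p" m] s pk by simp
  qed
  ultimately show False using p by (simp add: used_word_Suc)
qed

definition flippable :: "nat set \<Rightarrow> nat \<Rightarrow> bool" where
  "flippable J k \<longleftrightarrow> k < m \<and> k \<notin> J \<and> descent (used_word J 0 k) (Q ! k)"

text \<open>Exchange removes a position \<open>t\<close> of \<open>J\<close> before \<open>k\<close>, and using \<open>k\<close> instead restores the element.\<close>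

lemma flip_exists:
  assumes J: "expresses J" and k: "flippable J k"
  shows "\<exists>C. expresses C \<and> k \<in> C \<and> (\<forall>i>k. i \<in> C \<longleftrightarrow> i \<in> J)"
proof -
  have km: "k < m" "k \<notin> J" using k by (auto simp: flippable_def)
  obtain u j v where uv: "used_word J 0 k = u @ j # v" "used_word J 0 k @ [Q ! k] \<approx> u @ v"
    using exchange[OF _ letter_less[OF km(1)]] k unfolding flippable_def by blast
  obtain t where t: "t < k" "t \<in> J" "used_word (J - {t}) 0 k = u @ v" using used_word_delete[OF uv(1)] by auto
  let ?C = "insert k (J - {t})"
  have "used_word ?C 0 k = u @ v" using t(3) by (subst t(3)[symmetric], intro used_word_cong) auto
  moreover have "used_word ?C (Suc k) m = used_word J (Suc k) m" using t by (intro used_word_cong) auto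
  ultimately have C: "used_word ?C 0 m = (u @ v) @ Q ! k # used_word J (Suc k) m"
    using used_word_split[of 0 k m ?C] used_word_first[of k m ?C] km by simp
  have J2: "used_word J 0 m = used_word J 0 k @ used_word J (Suc k) m"
    using used_word_split[of 0 k m J] used_word_first[of k m J] km by simp
  have "(u @ v) @ Q ! k # used_word J (Suc k) m \<approx> (used_word J 0 k @ [Q ! k]) @ Q ! k # used_word J (Suc k) m"
    by (intro weq_append weq_sym[OF uv(2)]) auto
  also have "\<dots> \<approx> used_word J 0 m" unfolding J2 by (simp add: weq_def)
  also have "\<dots> \<approx> r" using J by (simp add: expresses_def)
  finally have "used_word ?C 0 m \<approx> r" using C by simp
  moreover have "length (used_word ?C 0 m) = length r"
    using C J2 uv(1) J by (simp add: expresses_def)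
  moreover have "?C \<subseteq> {..<m}" using J km by (auto simp: expresses_def)
  ultimately have "expresses ?C" by (simp add: expresses_def)
  then show ?thesis using t by (intro exI[of _ ?C]) auto
qed

text \<open>At the largest position where a larger set \<open>C\<close> differs from \<open>J\<close>, the prefix of \<open>C\<close> ends in
  that letter and is equivalent to the prefix of \<open>J\<close>, so the letter is a descent of the latter.\<close>

lemma above_flippable:
  assumes J: "expresses J" and C: "expresses C"
    and p: "p \<notin> J" "p \<in> C" "\<forall>i>p. i \<in> J \<longleftrightarrow> i \<in> C"
  shows "flippable J p"
proof -
  have pm: "p < m" using C p by (auto simp: expresses_def)
  have s: "used_word C (Suc p) m = used_word J (Suc p) m" using p by (intro used_word_cong) auto
  have "used_word C 0 (Suc p) @ used_word C (Suc p) m \<approx> r" "used_word J 0 (Suc p) @ used_word J (Suc p) m \<approx> r"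
    using C J pm used_word_split[of 0 "Suc p" m] by (auto simp: expresses_def)
  then have "used_word C 0 (Suc p) \<approx> used_word J 0 (Suc p)"
    unfolding s using weq_move_right weq_sym weq_trans by meson
  then have e: "used_word C 0 p @ [Q ! p] \<approx> used_word J 0 p" using p by (simp add: used_word_Suc)
  have "reduced (used_word C 0 p @ [Q ! p])"
    using expresses_reduced_part[OF C, of 0 "Suc p"] pm p by (simp add: used_word_Suc)
  then have "descent (used_word C 0 p @ [Q ! p]) (Q ! p)" using reduced_snoc_descent pm by simp
  then show ?thesis using descent_cong[OF e] pm p by (simp add: flippable_def)
qed

definition successor :: "nat set \<Rightarrow> nat \<Rightarrow> nat set \<Rightarrow> bool" where
  "successor J k G \<longleftrightarrow> flippable J k \<and> (\<forall>p<k. \<not> flippable J p) \<and> G \<subseteq> {..<m} \<and> k \<in> G \<and>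
     (\<forall>i>k. i \<in> G \<longleftrightarrow> i \<in> J) \<and> left_greedy (used_word G k m @ rev r) G k"

lemma successor_expresses:
  assumes J: "expresses J" and G: "successor J k G" shows "expresses G"
proof -
  obtain C where C: "expresses C" "k \<in> C" "\<forall>i>k. i \<in> C \<longleftrightarrow> i \<in> J"
    using flip_exists[OF J, of k] G by (auto simp only: successor_def)
  then have "\<forall>i\<ge>k. i \<in> G \<longleftrightarrow> i \<in> C" using G by (auto simp: successor_def le_less)
  then show ?thesis
    using refill_expresses[OF C(1), of k G] G by (auto simp: successor_def flippable_def)
qed

text \<open>Nothing lies between \<open>J\<close> and \<open>G\<close>. For a set above \<open>J\<close> the largest position of difference is
  flippable, hence not before \<open>k\<close>. If it is after \<open>k\<close>, the set is also above \<open>G\<close>; if it is \<open>k\<close>,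
  the set agrees with \<open>G\<close> from \<open>k\<close> on and \<open>refill_least\<close> applies.\<close>

lemma below_successor_iff:
  assumes J: "expresses J" and G: "successor J k G" and C: "expresses C"
  shows "C \<sqsubset> G \<longleftrightarrow> C \<sqsubset> J \<or> C = J"
proof
  have "J \<sqsubset> G" unfolding below_def by (rule exI[of _ k]) (use G in \<open>auto simp: successor_def flippable_def\<close>)
  then show "C \<sqsubset> J \<or> C = J \<Longrightarrow> C \<sqsubset> G" using below_trans by blast
next
  assume CG: "C \<sqsubset> G"
  show "C \<sqsubset> J \<or> C = J"
  proof (rule ccontr)
    assume "\<not> ?thesis"
    then have "J \<sqsubset> C" using below_total[of J C] J C by (auto simp: expresses_def)
    then obtain p where p: "p \<notin> J" "p \<in> C" "\<forall>i>p. i \<in> J \<longleftrightarrow> i \<in> C" by (auto simp: below_def)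
    have "flippable J p" using above_flippable[OF J C p] .
    then have "\<not> p < k" using G by (auto simp: successor_def)
    then consider "p = k" | "k < p" by linarith
    then show False
    proof cases
      case 1
      then have "\<forall>i\<ge>k. i \<in> C \<longleftrightarrow> i \<in> G" using p G by (auto simp: successor_def le_less)
      then show False
        using refill_least[OF successor_expresses[OF J G], of k C] G C CG
        by (auto simp: successor_def flippable_def)
    next
      case 2
      then have "G \<sqsubset> C" unfolding below_def
        by (intro exI[of _ p]) (use p G in \<open>auto simp: successor_def\<close>)
      then show False using CG below_asym by blast
    qed
  qed
qed

lemma last_if_not_flippable:
  assumes J: "expresses J" and "\<forall>p<m. \<not> flippable J p" and C: "expresses C"
  shows "C \<sqsubset> J \<or> C = J"
proof (rule ccontr)
  assume "\<not> ?thesis"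
  then have "J \<sqsubset> C" using below_total[of J C] J C by (auto simp: expresses_def)
  then obtain p where "p \<notin> J" "p \<in> C" "\<forall>i>p. i \<in> J \<longleftrightarrow> i \<in> C" by (auto simp: below_def)
  from above_flippable[OF J C this] show False using assms by (auto simp: flippable_def)
qed

lemma first_expresses:
  assumes "expresses C" "G \<subseteq> {..<m}" "left_greedy (rev r) G m" shows "expresses G"
  by (rule refill_expresses[OF assms(1), of m]) (use assms in \<open>auto simp: expresses_def\<close>)

lemma first_least:
  assumes "expresses G" "left_greedy (rev r) G m" "expresses C" shows "\<not> C \<sqsubset> G"
  by (rule refill_least[OF assms(1), of m]) (use assms in \<open>auto simp: expresses_def\<close>)

end

section \<open>Reasoning about program runs\<close>

text \<open>Total correctness with the running time as an argument of the postcondition. The set \<open>V\<close>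
  bounds the written cells and stays the same throughout, so space needs no bookkeeping of its own.\<close>

definition runs :: "machine_input \<Rightarrow> com \<Rightarrow> state \<Rightarrow> cell set \<Rightarrow> (nat \<Rightarrow> state \<Rightarrow> bool) \<Rightarrow> bool" where
  "runs I c s V P \<longleftrightarrow> (\<exists>t U s'. exec I c s t U s' \<and> U \<subseteq> V \<and> P t s')"

abbreviation then_com :: "com \<Rightarrow> com \<Rightarrow> com" (infixr ";;" 60) where
  "c ;; d \<equiv> Seq c d"

text \<open>For a basic command, determinism makes \<open>runs\<close> computable by rewriting.\<close>

lemma runs_exec: "exec I c s t U s' \<Longrightarrow> runs I c s V P \<longleftrightarrow> U \<subseteq> V \<and> P t s'"
  unfolding runs_def using exec_deterministic by metis

lemma runs_Skip: "runs I Skip s V P \<longleftrightarrow> P 1 s"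
  by (simp add: runs_exec[OF exec.Skip])

lemma runs_ISet: "runs I (ISet x e f) s V P \<longleftrightarrow> ICell x (ival I s e) \<in> V \<and>
    P (icost e + icost f + 1)
      (s\<lparr>imem := (imem s)(x := (imem s x)(ival I s e := ival I s f))\<rparr>)"
  by (simp add: runs_exec[OF exec.ISet[OF refl]])

lemma runs_RSet: "runs I (RSet x e f a) s V P \<longleftrightarrow> RCell x (ival I s e) (ival I s f) \<in> V \<and>
    P (icost e + icost f + rcost a + 1)
      (s\<lparr>rmem := (rmem s)(x := (rmem s x)(ival I s e :=
         (rmem s x (ival I s e))(ival I s f := rval I s a)))\<rparr>)"
  by (simp add: runs_exec[OF exec.RSet[OF refl refl]])

lemma runs_Emit: "runs I (Emit e) s V P \<longleftrightarrow>
    P (icost e + 1) (s\<lparr>pending := pending s @ [ival I s e]\<rparr>)"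
  by (simp add: runs_exec[OF exec.Emit])

lemma runs_EndFacet: "runs I EndFacet s V P \<longleftrightarrow>
    P 1 (s\<lparr>pending := [], produced := produced s @ [pending s]\<rparr>)"
  by (simp add: runs_exec[OF exec.EndFacet])

lemma runs_IfElse: "runs I (IfElse b c d) s V P \<longleftrightarrow>
    (if bval I s b then runs I c s V (\<lambda>t. P (bcost b + t + 1))
     else runs I d s V (\<lambda>t. P (bcost b + t + 1)))"
proof -
  have "exec I (IfElse b c d) s t U s' \<longleftrightarrow>
      (\<exists>t'. exec I (if bval I s b then c else d) s t' U s' \<and> t = bcost b + t' + 1)" for t U s'
    by (auto elim!: IfElse_elim simp del: One_nat_def add_Suc_right intro: exec.IfTrue exec.IfFalse)
  then show ?thesis unfolding runs_def by auto
qed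

lemma runs_Seq: "runs I (c ;; d) s V P \<longleftrightarrow>
    runs I c s V (\<lambda>t s'. runs I d s' V (\<lambda>t' s''. P (t + t') s''))"
proof -
  have "exec I (c ;; d) s t U s'' \<longleftrightarrow> (\<exists>t1 U1 s' t2 U2. exec I c s t1 U1 s' \<and> exec I d s' t2 U2 s'' \<and>
      t = t1 + t2 \<and> U = U1 \<union> U2)" for t U s''
    by (auto elim!: Seq_elim intro: exec.Seq) blast
  then show ?thesis unfolding runs_def by (auto; metis Un_least)
qed

lemmas runs_simps = runs_Skip runs_ISet runs_RSet runs_Emit runs_EndFacet runs_IfElse runs_Seq

lemma runs_weaken:
  "runs I c s V P \<Longrightarrow> (\<And>t s'. P t s' \<Longrightarrow> P' t s') \<Longrightarrow> runs I c s V P'"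
  unfolding runs_def by blast

text \<open>Every loop of the program, including the outermost, has a number of rounds known in
  advance, and the invariant is indexed by the number of completed rounds.\<close>

lemma runs_count:
  assumes step: "\<And>i s. i < N \<Longrightarrow> Inv i s \<Longrightarrow>
      bval I s b \<and> runs I c s V (\<lambda>t s'. t \<le> B \<and> Inv (Suc i) s')"
    and stop: "\<And>s. Inv N s \<Longrightarrow> \<not> bval I s b"
    and init: "Inv 0 s"
  shows "runs I (While b c) s V (\<lambda>t s'. t \<le> N * (B + bcost b + 1) + bcost b + 1 \<and> Inv N s')"
proof -
  have "\<forall>s. Inv i s \<longrightarrow>
      runs I (While b c) s V (\<lambda>t s'. t \<le> (N - i) * (B + bcost b + 1) + bcost b + 1 \<and> Inv N s')"
    if "i \<le> N" for i
    using that
  proof (induction i rule: inc_induct)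
    case base
    show ?case
      unfolding runs_def using stop
      by (metis add_0 diff_self_eq_0 empty_subsetI exec.WhileFalse mult_0 order_refl)
  next
    case (step i)
    show ?case
    proof (intro allI impI)
      fix s assume "Inv i s"
      from assms(1)[OF step.hyps(2) this] obtain t U s' where 1: "bval I s b" "exec I c s t U s'"
        "U \<subseteq> V" "t \<le> B" "Inv (Suc i) s'" unfolding runs_def by blast
      from step.IH 1(5) obtain t' U' s'' where 2: "exec I (While b c) s' t' U' s''" "U' \<subseteq> V"
        "t' \<le> (N - Suc i) * (B + bcost b + 1) + bcost b + 1" "Inv N s''" unfolding runs_def by blast
      have "exec I (While b c) s (bcost b + t + t' + 1) (U \<union> U') s''"
        using exec.WhileTrue[OF 1(1,2) 2(1)] .
      moreover have "N - i = Suc (N - Suc i)" using step.hyps by simp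
      then have "bcost b + t + t' + 1 \<le> (N - i) * (B + bcost b + 1) + bcost b + 1"
        using 1(4) 2(3) by simp
      ultimately show "runs I (While b c) s V
          (\<lambda>t s'. t \<le> (N - i) * (B + bcost b + 1) + bcost b + 1 \<and> Inv N s')"
        unfolding runs_def using 1(3) 2(2,4) by blast
    qed
  qed
  from this[of 0] show ?thesis using init by simp
qed

text \<open>Only the index memory is framed: the real memory is described by \<open>represents\<close> below.\<close>

definition frame :: "name set \<Rightarrow> state \<Rightarrow> state \<Rightarrow> bool" where
  "frame X s s' \<longleftrightarrow> (\<forall>x. x \<notin> X \<longrightarrow> imem s' x = imem s x) \<and>
     pending s' = pending s \<and> produced s' = produced s"

lemma frame_refl [simp]: "frame X s s" by (simp add: frame_def)

lemma frame_trans: "frame X s s' \<Longrightarrow> frame Y s' s'' \<Longrightarrow> X \<subseteq> Z \<Longrightarrow> Y \<subseteq> Z \<Longrightarrow> frame Z s s''"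
  unfolding frame_def by (metis subsetD)

section \<open>The program\<close>

text \<open>Index variables: \<open>x\<close> is the letter to reflect in, \<open>j\<close> runs over coordinates, \<open>i\<close> over the
  letters of a word being applied, \<open>p\<close> over positions, \<open>k\<close> is the flipped position and bounds
  the positions to be refilled, \<open>g\<close> tells whether to go on, and the array \<open>b\<close> marks the used positions. Real variables: \<open>v\<close> is the current root, \<open>h\<close>
  its height, \<open>d\<close> and \<open>a\<close> are inner products. Positions are counted from 0 until they are output.\<close>

abbreviation var :: "name \<Rightarrow> iexp" where "var x \<equiv> IGet x (IConst 0)"
abbreviation rvar :: "name \<Rightarrow> rexp" where "rvar x \<equiv> RGet x (IConst 0) (IConst 0)"
abbreviation assign :: "name \<Rightarrow> iexp \<Rightarrow> com" where "assign x \<equiv> ISet x (IConst 0)"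
abbreviation rassign :: "name \<Rightarrow> rexp \<Rightarrow> com" where "rassign x \<equiv> RSet x (IConst 0) (IConst 0)"
abbreviation incr :: "name \<Rightarrow> com" where "incr x \<equiv> assign x (IPlus (var x) (IConst 1))"
abbreviation decr :: "name \<Rightarrow> com" where "decr x \<equiv> assign x (IMinus (var x) (IConst 1))"
abbreviation coord :: rexp where "coord \<equiv> RGet ''v'' (IConst 0) (var ''j'')"
abbreviation root_coord :: rexp where "root_coord \<equiv> RootCoord (var ''x'') (var ''j'')"

definition dot :: com where
  "dot =
     rassign ''d'' RZero ;; rassign ''a'' RZero ;; assign ''j'' (IConst 0) ;;
     While (ILess (var ''j'') Rank)
      (rassign ''d'' (RPlus (rvar ''d'') (RTimes coord root_coord)) ;;
       rassign ''a'' (RPlus (rvar ''a'') (RTimes root_coord root_coord)) ;;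
       incr ''j'')"

definition subtract_multiple :: com where
  "subtract_multiple =
     rassign ''d'' (RDivide (RPlus (rvar ''d'') (rvar ''d'')) (rvar ''a'')) ;;
     rassign ''h'' (RMinus (rvar ''h'') (rvar ''d'')) ;;
     assign ''j'' (IConst 0) ;;
     While (ILess (var ''j'') Rank)
      (RSet ''v'' (IConst 0) (var ''j'') (RMinus coord (RTimes (rvar ''d'') root_coord)) ;;
       incr ''j'')"

definition reflect :: com where
  "reflect = dot ;; subtract_multiple"

definition load :: com where
  "load =
     rassign ''h'' ROne ;; assign ''j'' (IConst 0) ;;
     While (ILess (var ''j'') Rank)
      (RSet ''v'' (IConst 0) (var ''j'') root_coord ;; incr ''j'')"

text \<open>The rightmost letter of a word acts first, so positions are visited in decreasing order;
  \<open>reflect_elem\<close> runs upwards, since it applies the reversed word of the group element.\<close>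

definition reflect_used :: "iexp \<Rightarrow> iexp \<Rightarrow> com" where
  "reflect_used lo hi =
     assign ''i'' hi ;;
     While (ILess lo (var ''i''))
      (decr ''i'' ;;
       IfElse (ILess (IConst 0) (IGet ''b'' (var ''i'')))
         (assign ''x'' (WordLetter (var ''i'')) ;; reflect)
         Skip)"

definition reflect_elem :: com where
  "reflect_elem =
     assign ''i'' (IConst 0) ;;
     While (ILess (var ''i'') ElemLen)
      (assign ''x'' (ElemLetter (var ''i'')) ;; reflect ;; incr ''i'')"

definition emit_facet :: com where
  "emit_facet =
     assign ''p'' (IConst 0) ;;
     While (ILess (var ''p'') WordLen)
      (IfElse (ILess (IConst 0) (IGet ''b'' (var ''p'')))
         Skip
         (Emit (IPlus (var ''p'') (IConst 1))) ;;
       incr ''p'') ;;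
     EndFacet"

text \<open>For a position \<open>p\<close>, the sign of \<open>h\<close> tells after \<open>right_test\<close> whether the letter of \<open>p\<close> is a right
  descent of the prefix before \<open>p\<close>, and after \<open>left_test\<close> whether it is a left descent of what remains
  to be expressed between \<open>p\<close> and \<open>k\<close>. The bits between \<open>p\<close> and \<open>k\<close> are never read, so \<open>refill\<close> may
  leave stale values there.\<close>

definition right_test :: com where
  "right_test =
     assign ''x'' (WordLetter (var ''p'')) ;; load ;; reflect_used (IConst 0) (var ''p'')"

definition left_test :: com where
  "left_test = right_test ;; reflect_elem ;; reflect_used (var ''k'') WordLen"

definition refill :: com where
  "refill =
     assign ''p'' (IConst 0) ;;
     While (ILess (var ''p'') (var ''k''))
      (left_test ;;
       IfElse (RLess (rvar ''h'') RZero)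
         (ISet ''b'' (var ''p'') (IConst 1))
         (ISet ''b'' (var ''p'') (IConst 0)) ;;
       incr ''p'')"

text \<open>The scan goes downwards, so the last assignment to \<open>k\<close> stores the least flippable position. It
  stores the successor of that position, and 0 says that there is none.\<close>

definition find_flip :: com where
  "find_flip =
     assign ''k'' (IConst 0) ;; assign ''p'' WordLen ;;
     While (ILess (IConst 0) (var ''p''))
      (decr ''p'' ;;
       IfElse (ILess (IConst 0) (IGet ''b'' (var ''p'')))
         Skip
         (right_test ;;
          IfElse (RLess (rvar ''h'') RZero)
            (assign ''k'' (IPlus (var ''p'') (IConst 1)))
            Skip))"

definition enumerate_step :: com where
  "enumerate_step =
     emit_facet ;; find_flip ;;
     IfElse (ILess (IConst 0) (var ''k''))
       (decr ''k'' ;; ISet ''b'' (var ''k'') (IConst 1) ;; refill)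
       (assign ''g'' (IConst 0))"

definition enumerate_facets :: com where
  "enumerate_facets =
     assign ''k'' WordLen ;; refill ;; assign ''g'' (IConst 1) ;;
     While (ILess (IConst 0) (var ''g'')) enumerate_step"

section \<open>Correctness and cost of the program parts\<close>

text \<open>The numerical constants in the time bounds are generous and have no significance. A loop with
  at most \<open>m\<close> rounds of cost \<open>O(n)\<close> is in \<open>O(mn)\<close>, lower order terms included, because \<open>m\<close> and \<open>n\<close> are
  positive.\<close>

lemma loop_bound:
  fixes N m n d B t c :: nat
  assumes "t \<le> N * (B + c + 1) + c + 1" "N \<le> m" "B \<le> d * n" "c \<le> 10" "0 < m" "0 < n"
  shows "t + 20 \<le> (d + 50) * m * n"
proof -
  have "N * (B + c + 1) \<le> m * (d * n + 11 * n)"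
    using assms by (intro mult_le_mono) auto
  moreover have "31 * 1 \<le> 39 * (m * n)" using assms by (intro mult_le_mono) auto
  ultimately show ?thesis using assms(1,4) by (simp add: algebra_simps)
qed

locale expressible_problem = subword_problem +
  assumes expressible: "\<exists>J. expresses J"
begin

abbreviation inp :: machine_input where
  "inp \<equiv> \<lparr>in_rank = n, in_word = Q, in_roots = \<Delta>, in_elem = r\<rparr>"

text \<open>No letter is ever loaded when \<open>Q\<close> is empty. Then the vector must not be counted, since \<open>n\<close> is
  not bounded by \<open>mn\<close>.\<close>

definition cells :: "cell set" where
  "cells = (\<lambda>x. ICell x 0) ` {''g'', ''i'', ''j'', ''k'', ''p'', ''x''} \<union>
     (\<lambda>x. RCell x 0 0) ` {''a'', ''d'', ''h''} \<union>
     ICell ''b'' ` {..<m} \<union> (if m = 0 then {} else RCell ''v'' 0 ` {..<n})"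

lemma finite_cells: "finite cells" by (simp add: cells_def)

lemma cells_simps [simp]:
  "x \<in> {''g'', ''i'', ''j'', ''k'', ''p'', ''x''} \<Longrightarrow> ICell x 0 \<in> cells"
  "y \<in> {''a'', ''d'', ''h''} \<Longrightarrow> RCell y 0 0 \<in> cells"
  "p < m \<Longrightarrow> ICell ''b'' p \<in> cells"
  "l < n \<Longrightarrow> 0 < m \<Longrightarrow> RCell ''v'' 0 l \<in> cells"
  by (auto simp: cells_def)

lemma read_word [simp]: "p < m \<Longrightarrow> read Q p = Q ! p"
  and read_elem [simp]: "p < length r \<Longrightarrow> read r p = r ! p"
  and read_root_simp [simp]: "i < n \<Longrightarrow> l < n \<Longrightarrow> read_root inp i l = \<Delta> ! i $ l"
  by (auto simp: read_def read_root_def length_simple)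

lemma length_r: "length r \<le> m"
proof -
  obtain J where "expresses J" using expressible by blast
  then have "length r = card J" "J \<subseteq> {..<m}" using length_used_word by (auto simp: expresses_def)
  then show ?thesis using card_mono[of "{..<m}" J] by simp
qed

definition bits :: "state \<Rightarrow> nat set" where
  "bits s = {p. p < m \<and> 0 < imem s ''b'' p}"

definition represents :: "state \<Rightarrow> real vec \<Rightarrow> bool" where
  "represents s x \<longleftrightarrow> x \<in> carrier_vec n \<and> (\<forall>l<n. rmem s ''v'' 0 l = x $ l) \<and> rmem s ''h'' 0 0 = height x"

lemma bits_frame: "frame X s s' \<Longrightarrow> ''b'' \<notin> X \<Longrightarrow> bits s' = bits s"
  by (simp add: bits_def frame_def)

lemma runs_dot:
  assumes x: "imem s ''x'' 0 = i" "i < n" and m: "0 < m"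
  shows "runs inp dot s cells (\<lambda>t s'. t \<le> 100 * n \<and>
    rmem s' ''d'' 0 0 = (\<Sum>l<n. rmem s ''v'' 0 l * \<Delta> ! i $ l) \<and>
    rmem s' ''a'' 0 0 = (\<Sum>l<n. \<Delta> ! i $ l * \<Delta> ! i $ l) \<and>
    rmem s' ''v'' = rmem s ''v'' \<and> rmem s' ''h'' = rmem s ''h'' \<and> frame {''j''} s s')"
proof -
  define Inv where "Inv k s' \<longleftrightarrow> imem s' ''j'' 0 = k \<and>
    rmem s' ''d'' 0 0 = (\<Sum>l<k. rmem s ''v'' 0 l * \<Delta> ! i $ l) \<and>
    rmem s' ''a'' 0 0 = (\<Sum>l<k. \<Delta> ! i $ l * \<Delta> ! i $ l) \<and>
    rmem s' ''v'' = rmem s ''v'' \<and> rmem s' ''h'' = rmem s ''h'' \<and> frame {''j''} s s'" for k s'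
  show ?thesis
    unfolding dot_def
    apply (simp add: runs_simps)
    apply (rule runs_weaken[OF runs_count[where Inv = Inv and N = n and B = 50]])
    subgoal for k s' using x by (simp add: runs_simps Inv_def frame_def)
    subgoal for s' by (simp add: Inv_def)
    subgoal by (simp add: Inv_def frame_def)
    subgoal for t s' using x by (simp add: Inv_def)
    done
qed

lemma runs_subtract_multiple:
  assumes x: "imem s ''x'' 0 = i" "i < n" and m: "0 < m"
  shows "runs inp subtract_multiple s cells (\<lambda>t s'. t \<le> 100 * n \<and>
    (\<forall>l<n. rmem s' ''v'' 0 l = rmem s ''v'' 0 l - 2 * rmem s ''d'' 0 0 / rmem s ''a'' 0 0 * \<Delta> ! i $ l) \<and>
    rmem s' ''h'' 0 0 = rmem s ''h'' 0 0 - 2 * rmem s ''d'' 0 0 / rmem s ''a'' 0 0 \<and>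
    frame {''j''} s s')"
proof -
  define c where "c = 2 * rmem s ''d'' 0 0 / rmem s ''a'' 0 0"
  define Inv where "Inv k s' \<longleftrightarrow> imem s' ''j'' 0 = k \<and> rmem s' ''d'' 0 0 = c \<and>
    (\<forall>l. rmem s' ''v'' 0 l = rmem s ''v'' 0 l - (if l < k then c * \<Delta> ! i $ l else 0)) \<and>
    rmem s' ''h'' 0 0 = rmem s ''h'' 0 0 - c \<and> frame {''j''} s s'" for k s'
  show ?thesis
    unfolding subtract_multiple_def c_def[symmetric]
    apply (simp add: runs_simps)
    apply (rule runs_weaken[OF runs_count[where Inv = Inv and N = n and B = 50]])
    subgoal for k s' using x m by (simp add: runs_simps Inv_def frame_def)
    subgoal for s' by (simp add: Inv_def)
    subgoal by (simp add: Inv_def frame_def c_def)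
    subgoal for t s' using x by (simp add: Inv_def)
    done
qed

text \<open>The multiplier of the reflection is subtracted from the height by \<open>height_shift\<close>.\<close>

lemma runs_reflect:
  assumes x: "imem s ''x'' 0 = i" "i < n" and m: "0 < m" and represents: "represents s y"
  shows "runs inp reflect s cells (\<lambda>t s'. t \<le> 200 * n \<and> represents s' (simple_refl i y) \<and> frame {''j''} s s')"
proof -
  have y: "y \<in> carrier_vec n" "\<And>l. l < n \<Longrightarrow> rmem s ''v'' 0 l = y $ l" "rmem s ''h'' 0 0 = height y"
    using represents by (auto simp: represents_def)
  have d: "(\<Sum>l<n. rmem s ''v'' 0 l * \<Delta> ! i $ l) = \<Delta> ! i \<bullet> y"
    using y by (auto simp: scalar_prod_def atLeast0LessThan mult.commute intro!: sum.cong)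
  have a: "(\<Sum>l<n. \<Delta> ! i $ l * \<Delta> ! i $ l) = \<Delta> ! i \<bullet> \<Delta> ! i"
    using x by (simp add: scalar_prod_def atLeast0LessThan)
  show ?thesis
    unfolding reflect_def runs_Seq
  proof (rule runs_weaken[OF runs_dot[OF x m]], elim conjE, unfold d a)
    fix t s'
    assume s': "t \<le> 100 * n" "rmem s' ''d'' 0 0 = \<Delta> ! i \<bullet> y" "rmem s' ''a'' 0 0 = \<Delta> ! i \<bullet> \<Delta> ! i"
      "rmem s' ''v'' = rmem s ''v''" "rmem s' ''h'' = rmem s ''h''" "frame {''j''} s s'"
    have x': "imem s' ''x'' 0 = i" using s'(6) x by (simp add: frame_def)
    show "runs inp subtract_multiple s' cells
        (\<lambda>t' s''. t + t' \<le> 200 * n \<and> represents s'' (simple_refl i y) \<and> frame {''j''} s s'')"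
    proof (rule runs_weaken[OF runs_subtract_multiple[OF x' x(2) m]], elim conjE, unfold s'(2-5))
      fix t' s''
      assume "t' \<le> 100 * n" "frame {''j''} s' s''"
        "\<forall>l<n. rmem s'' ''v'' 0 l = rmem s ''v'' 0 l -
          2 * (\<Delta> ! i \<bullet> y) / (\<Delta> ! i \<bullet> \<Delta> ! i) * \<Delta> ! i $ l"
        "rmem s'' ''h'' 0 0 = rmem s ''h'' 0 0 - 2 * (\<Delta> ! i \<bullet> y) / (\<Delta> ! i \<bullet> \<Delta> ! i)"
      then show "t + t' \<le> 200 * n \<and> represents s'' (simple_refl i y) \<and> frame {''j''} s s''"
        using s'(1,6) x y by (auto simp: represents_def simple_refl_eq height_shift intro: frame_trans)
    qed
  qed
qed

lemma runs_load:
  assumes x: "imem s ''x'' 0 = i" "i < n" and m: "0 < m"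
  shows "runs inp load s cells (\<lambda>t s'. t \<le> 100 * n \<and> represents s' (\<Delta> ! i) \<and> frame {''j''} s s')"
proof -
  define Inv where "Inv k s' \<longleftrightarrow> imem s' ''j'' 0 = k \<and> rmem s' ''h'' 0 0 = 1 \<and>
    (\<forall>l<k. rmem s' ''v'' 0 l = \<Delta> ! i $ l) \<and> frame {''j''} s s'" for k s'
  show ?thesis
    unfolding load_def
    apply (simp add: runs_simps)
    apply (rule runs_weaken[OF runs_count[where Inv = Inv and N = n and B = 50]])
    subgoal for k s' using x m by (simp add: runs_simps Inv_def frame_def less_Suc_eq)
    subgoal for s' by (simp add: Inv_def)
    subgoal by (simp add: Inv_def frame_def)
    subgoal for t s' using x by (simp add: Inv_def represents_def height_simple)
    done
qed

lemma rank_pos: "0 < m \<Longrightarrow> 0 < n"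
  using letter_less[of 0] by linarith

lemma represents_update [simp]:
  "represents (s\<lparr>imem := f\<rparr>) = represents s" "represents (s\<lparr>pending := l\<rparr>) = represents s" "represents (s\<lparr>produced := ls\<rparr>) = represents s"
  by (simp_all add: represents_def fun_eq_iff)

lemma in_bits: "p < m \<Longrightarrow> p \<in> bits s \<longleftrightarrow> 0 < imem s ''b'' p"
  by (simp add: bits_def)

lemma runs_reflect_used:
  assumes lo: "\<And>s'. frame {''i'', ''j'', ''x''} s s' \<Longrightarrow> ival inp s' lo = a" "icost lo \<le> 2"
    and hi: "ival inp s hi = b" "icost hi \<le> 2"
    and ab: "a \<le> b" "b \<le> m" and m: "0 < m" and represents: "represents s y"
  shows "runs inp (reflect_used lo hi) s cells (\<lambda>t s'. t \<le> 270 * m * n \<and>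
    represents s' (act (used_word (bits s) a b) y) \<and> frame {''i'', ''j'', ''x''} s s')"
proof -
  let ?X = "{''i'', ''j'', ''x''}" let ?J = "bits s"
  define Inv where "Inv c s' \<longleftrightarrow> imem s' ''i'' 0 = b - c \<and>
    represents s' (act (used_word ?J (b - c) b) y) \<and> frame ?X s s'" for c and s' :: state
  show ?thesis
    unfolding reflect_used_def
    apply (simp add: runs_simps hi(1) del: One_nat_def)
    apply (rule runs_weaken[OF runs_count[where Inv = Inv and N = "b - a" and B = "200 * n + 20"]])
    subgoal premises pr for c s'
    proof -
      let ?p = "b - Suc c"
      have p: "?p < b" "?p < m" "Suc ?p = b - c" "a < b - c" using pr(1) ab by auto
      have s': "imem s' ''i'' 0 = b - c" "represents s' (act (used_word ?J (b - c) b) y)" "frame ?X s s'"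
        using pr(2) by (auto simp: Inv_def)
      have bit: "0 < imem s' ''b'' ?p \<longleftrightarrow> ?p \<in> ?J"
        using in_bits[OF p(2), of s] s'(3) by (simp add: frame_def)
      have split: "used_word ?J ?p b = (if ?p \<in> ?J then [Q ! ?p] else []) @ used_word ?J (b - c) b"
        using used_word_first[OF p(1), of ?J] unfolding p(3) .
      show ?thesis
      proof (intro conjI)
        show "bval inp s' (ILess lo (var ''i''))" using s' lo p by simp
        show "runs inp (decr ''i'' ;;
            IfElse (ILess (IConst 0) (IGet ''b'' (var ''i'')))
             (assign ''x'' (WordLetter (var ''i'')) ;; reflect) Skip) s' cells
            (\<lambda>t s'. t \<le> 200 * n + 20 \<and> Inv (Suc c) s')"
        proof (cases "?p \<in> ?J")
          case True
          have b: "0 < imem s' ''b'' (b - Suc c)" using True bit by simp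
          show ?thesis
            apply (simp add: runs_simps s'(1) b)
            apply (rule runs_weaken[OF runs_reflect[where i = "Q ! ?p" and y = "act (used_word ?J (b - c) b) y"]])
            subgoal using p by simp
            subgoal using p by simp
            subgoal using m by simp
            subgoal using s' by simp
            subgoal for t s'' using s' split True by (simp add: Inv_def frame_def)
            done
        next
          case False
          have b: "\<not> 0 < imem s' ''b'' (b - Suc c)" using False bit by simp
          show ?thesis
            using s' split False b by (simp add: runs_simps Inv_def frame_def)
        qed
      qed
    qed
    subgoal for s' using lo(1) ab by (simp add: Inv_def)
    subgoal using represents by (simp add: Inv_def frame_def)
    subgoal premises pr for t s'
    proof -
      have "t + 20 \<le> (220 + 50) * m * n"
        by (rule loop_bound[OF conjunct1[OF pr]])
          (use ab lo(2) m rank_pos in auto)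
      then show ?thesis using pr hi(2) ab by (simp add: Inv_def)
    qed
    done
qed

lemma runs_reflect_elem:
  assumes m: "0 < m" and represents: "represents s y"
  shows "runs inp reflect_elem s cells (\<lambda>t s'. t \<le> 270 * m * n \<and>
    represents s' (act (rev r) y) \<and> frame {''i'', ''j'', ''x''} s s')"
proof -
  let ?X = "{''i'', ''j'', ''x''}"
  define Inv where "Inv c s' \<longleftrightarrow> imem s' ''i'' 0 = c \<and>
    represents s' (act (rev (take c r)) y) \<and> frame ?X s s'" for c and s' :: state
  show ?thesis
    unfolding reflect_elem_def
    apply (simp add: runs_simps)
    apply (rule runs_weaken[OF runs_count[where Inv = Inv and N = "length r" and B = "200 * n + 20"]])
    subgoal premises pr for c s'
    proof -
      have s': "imem s' ''i'' 0 = c" "represents s' (act (rev (take c r)) y)" "frame ?X s s'"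
        using pr(2) by (auto simp: Inv_def)
      have rc: "r ! c < n" using pr(1) r_letters nth_mem by blast
      show ?thesis
        using pr(1)
        apply (simp add: runs_simps s'(1))
        apply (rule runs_weaken[OF runs_reflect[where i = "r ! c" and y = "act (rev (take c r)) y"]])
        subgoal by simp
        subgoal by (rule rc)
        subgoal using m by simp
        subgoal using s' by simp
        subgoal for t s'' using s' by (simp add: Inv_def frame_def take_Suc_conv_app_nth)
        done
    qed
    subgoal for s' by (simp add: Inv_def)
    subgoal using represents by (simp add: Inv_def frame_def)
    subgoal premises pr for t s'
    proof -
      have "t + 20 \<le> (220 + 50) * m * n"
        by (rule loop_bound[OF conjunct1[OF pr]])
          (use length_r m rank_pos in auto)
      then show ?thesis using pr by (simp add: Inv_def)
    qed
    done
qed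

lemma runs_right_test:
  assumes p: "imem s ''p'' 0 = p" "p < m"
  shows "runs inp right_test s cells (\<lambda>t s'. t \<le> 400 * m * n \<and>
    represents s' (act (used_word (bits s) 0 p) (\<Delta> ! (Q ! p))) \<and> frame {''i'', ''j'', ''x''} s s')"
proof -
  let ?X = "{''i'', ''j'', ''x''}"
  have m: "0 < m" using p by linarith
  have "1 * n \<le> m * n" using m by (intro mult_le_mono) (use m in linarith, simp)
  then have b: "10 + 100 * n \<le> 110 * m * n" using rank_pos[OF m] unfolding mult.assoc by linarith
  show ?thesis
    unfolding right_test_def using p
    apply (simp add: runs_simps)
    apply (rule runs_weaken[OF runs_load[where i = "Q ! p"]])
    subgoal by simp
    subgoal by simp
    subgoal using m by simp
    subgoal premises pr for t s'
    proof -
      have s': "frame ?X s s'" "represents s' (\<Delta> ! (Q ! p))" "t \<le> 100 * n" using pr by (auto simp: frame_def)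
      have bits: "bits s' = bits s" using bits_frame[OF s'(1)] by simp
      show ?thesis
        apply (rule runs_weaken[OF runs_reflect_used[where a = 0 and b = p and y = "\<Delta> ! (Q ! p)"]])
        subgoal by simp
        subgoal by simp
        subgoal using s'(1) p by (simp add: frame_def)
        subgoal by simp
        subgoal by simp
        subgoal using p by simp
        subgoal by (rule m)
        subgoal by (rule s'(2))
        subgoal for t' s'' using s' b bits by (auto intro: frame_trans)
        done
    qed
    done
qed

lemma runs_left_test:
  assumes p: "imem s ''p'' 0 = p" "p < m" and k: "imem s ''k'' 0 = k" "k \<le> m"
  shows "runs inp left_test s cells (\<lambda>t s'. t \<le> 1000 * m * n \<and>
    represents s' (act (used_word (bits s) k m @ rev r @ used_word (bits s) 0 p) (\<Delta> ! (Q ! p))) \<and>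
    frame {''i'', ''j'', ''x''} s s')"
proof -
  let ?X = "{''i'', ''j'', ''x''}"
  have m: "0 < m" using p by linarith
  let ?y = "act (used_word (bits s) 0 p) (\<Delta> ! (Q ! p))"
  show ?thesis
    unfolding left_test_def runs_Seq
  proof (rule runs_weaken[OF runs_right_test[OF p]], elim conjE)
    fix t1 s1 assume s1: "t1 \<le> 400 * m * n" "represents s1 ?y" "frame ?X s s1"
    show "runs inp reflect_elem s1 cells (\<lambda>t s'. runs inp (reflect_used (var ''k'') WordLen) s' cells
      (\<lambda>t' s''. t1 + (t + t') \<le> 1000 * m * n \<and>
        represents s'' (act (used_word (bits s) k m @ rev r @ used_word (bits s) 0 p) (\<Delta> ! (Q ! p))) \<and> frame ?X s s''))"
    proof (rule runs_weaken[OF runs_reflect_elem[OF m s1(2)]], elim conjE)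
      fix t2 s2 assume s2: "t2 \<le> 270 * m * n" "represents s2 (act (rev r) ?y)" "frame ?X s1 s2"
      have f: "frame ?X s s2" using frame_trans[OF s1(3) s2(3)] by blast
      have bits: "bits s2 = bits s" using bits_frame[OF f] by simp
      show "runs inp (reflect_used (var ''k'') WordLen) s2 cells
        (\<lambda>t' s''. t1 + (t2 + t') \<le> 1000 * m * n \<and>
          represents s'' (act (used_word (bits s) k m @ rev r @ used_word (bits s) 0 p) (\<Delta> ! (Q ! p))) \<and> frame ?X s s'')"
        apply (rule runs_weaken[OF runs_reflect_used[where a = k and b = m and y = "act (rev r) ?y"]])
        subgoal for s' using f k by (simp add: frame_def)
        subgoal by simp
        subgoal by simp
        subgoal by simp
        subgoal by (rule k)
        subgoal by simp
        subgoal by (rule m)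
        subgoal by (rule s2(2))
        subgoal for t' s'' using s1(1) s2(1) f bits by (auto intro: frame_trans)
        done
    qed
  qed
qed

text \<open>Setting the bit of a position influences neither the bits from \<open>k\<close> on nor the tests at
  positions up to it, so the greedy condition is extended by one position in every round.\<close>

lemma runs_refill:
  assumes k: "imem s ''k'' 0 = k" "k \<le> m"
  shows "runs inp refill s cells (\<lambda>t s'. t \<le> 1100 * m * m * n + 20 \<and>
    (\<forall>i\<ge>k. i \<in> bits s' \<longleftrightarrow> i \<in> bits s) \<and>
    left_greedy (used_word (bits s') k m @ rev r) (bits s') k \<and> frame {''b'', ''i'', ''j'', ''p'', ''x''} s s')"
proof -
  let ?Y = "{''b'', ''i'', ''j'', ''p'', ''x''}"
  let ?T = "used_word (bits s) k m @ rev r"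
  define Inv where "Inv q s' \<longleftrightarrow> imem s' ''p'' 0 = q \<and> (\<forall>i\<ge>k. i \<in> bits s' \<longleftrightarrow> i \<in> bits s) \<and>
    left_greedy ?T (bits s') q \<and> frame ?Y s s'" for q and s' :: state
  show ?thesis
    unfolding refill_def
    apply (simp add: runs_simps del: One_nat_def)
    apply (rule runs_weaken[OF runs_count[where Inv = Inv and N = k and B = "1000 * m * n + 30"]])
    subgoal premises pr for q s'
    proof -
      have q: "q < m" "q < k" using pr(1) k by auto
      have s': "imem s' ''p'' 0 = q" "\<forall>i\<ge>k. i \<in> bits s' \<longleftrightarrow> i \<in> bits s"
        "left_greedy ?T (bits s') q" "frame ?Y s s'" using pr(2) by (auto simp: Inv_def)
      have ks': "imem s' ''k'' 0 = k" using s'(4) k by (simp add: frame_def)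
      have T: "used_word (bits s') k m = used_word (bits s) k m" using s'(2) by (intro used_word_cong) auto
      show ?thesis
      proof (intro conjI)
        show "bval inp s' (ILess (var ''p'') (var ''k''))" using s'(1) ks' q by simp
        show "runs inp (left_test ;; IfElse (RLess (rvar ''h'') RZero)
            (ISet ''b'' (var ''p'') (IConst 1)) (ISet ''b'' (var ''p'') (IConst 0)) ;; incr ''p'')
            s' cells (\<lambda>t s'. t \<le> 1000 * m * n + 30 \<and> Inv (Suc q) s')"
          unfolding runs_Seq[of inp left_test]
        proof (rule runs_weaken[OF runs_left_test[OF s'(1) q(1) ks' k(2)]], elim conjE, unfold T)
          fix t s2
          assume t: "t \<le> 1000 * m * n"
            and represents: "represents s2 (act (used_word (bits s) k m @ rev r @ used_word (bits s') 0 q) (\<Delta> ! (Q ! q)))"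
            and f: "frame {''i'', ''j'', ''x''} s' s2"
          let ?descent = "descent (?T @ used_word (bits s') 0 q) (Q ! q)"
          have h: "rmem s2 ''h'' 0 0 < 0 \<longleftrightarrow> ?descent" using represents by (simp add: represents_def descent_def)
          have p2: "imem s2 ''p'' 0 = q" using f s'(1) by (simp add: frame_def)
          have f2: "frame ?Y s s2" by (rule frame_trans[OF s'(4) f]) auto
          have b2: "imem s2 ''b'' = imem s' ''b''" using f by (simp add: frame_def)
          have step: "Inv (Suc q) s3"
            if "imem s3 ''p'' 0 = Suc q" "frame ?Y s2 s3" "bits s3 = (if ?descent then insert q (bits s') else bits s' - {q})"
            for s3
          proof -
            have c: "used_word (bits s3) 0 i = used_word (bits s') 0 i" if "i \<le> q" for i
              using that \<open>bits s3 = _\<close> by (intro used_word_cong) auto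
            have "left_greedy ?T (bits s3) (Suc q)"
              unfolding left_greedy_def
            proof (intro allI impI)
              fix i assume i: "i < Suc q"
              show "i \<in> bits s3 \<longleftrightarrow> descent (?T @ used_word (bits s3) 0 i) (Q ! i)"
              proof (cases "i = q")
                case True
                then show ?thesis using c[of q] that(3) by simp
              next
                case False
                then have "i < q" using i by simp
                moreover have "i \<in> bits s3 \<longleftrightarrow> i \<in> bits s'" using that(3) False by simp
                ultimately show ?thesis using s'(3) c[of i] by (simp add: left_greedy_def)
              qed
            qed
            moreover have "\<forall>i\<ge>k. i \<in> bits s3 \<longleftrightarrow> i \<in> bits s" using s'(2) that(3) q by auto
            moreover have "frame ?Y s s3" by (rule frame_trans[OF f2 that(2)]) auto
            ultimately show ?thesis using that(1) by (simp add: Inv_def)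
          qed
          show "runs inp (IfElse (RLess (rvar ''h'') RZero)
            (ISet ''b'' (var ''p'') (IConst 1)) (ISet ''b'' (var ''p'') (IConst 0)) ;; incr ''p'')
            s2 cells (\<lambda>t' s'. t + t' \<le> 1000 * m * n + 30 \<and> Inv (Suc q) s')"
          proof (cases ?descent)
            case True
            then show ?thesis
              using t q p2 h
              apply (simp add: runs_simps)
              apply (rule step)
              by (auto simp: frame_def b2 bits_def)
          next
            case False
            then show ?thesis
              using t q p2 h
              apply (simp add: runs_simps)
              apply (rule step)
              by (auto simp: frame_def b2 bits_def)
          qed
        qed
      qed
    qed
    subgoal for s' using k by (simp add: Inv_def frame_def)
    subgoal by (simp add: Inv_def frame_def left_greedy_def bits_def)
    subgoal premises pr for t s'
    proof -
      have inv: "(\<forall>i\<ge>k. i \<in> bits s' \<longleftrightarrow> i \<in> bits s)" "left_greedy ?T (bits s') k" "frame ?Y s s'"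
        using pr by (auto simp: Inv_def)
      have T: "used_word (bits s') k m = used_word (bits s) k m" using inv(1) by (intro used_word_cong) auto
      have "t \<le> k * (1000 * m * n + 36) + 10" using pr by (auto simp: algebra_simps)
      also have "k * (1000 * m * n + 36) \<le> m * (1100 * m * n)"
      proof (cases "m = 0")
        case False
        then have "1 * 1 \<le> m * n" using rank_pos by (intro mult_le_mono) (auto simp: Suc_le_eq)
        then have "1000 * m * n + 36 \<le> 1100 * m * n" unfolding mult.assoc by linarith
        then show ?thesis using k by (intro mult_le_mono) auto
      qed (use k in simp)
      finally show ?thesis using inv T by (simp add: algebra_simps)
    qed
    done
qed

definition facet_list :: "nat set \<Rightarrow> nat list" where
  "facet_list J = map Suc (filter (\<lambda>p. p \<notin> J) [0..<m])"

lemma runs_emit_facet: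
  assumes "pending s = []"
  shows "runs inp emit_facet s cells (\<lambda>t s'. t \<le> 40 * m + 20 \<and> pending s' = [] \<and>
    produced s' = produced s @ [facet_list (bits s)] \<and> (\<forall>x. x \<noteq> ''p'' \<longrightarrow> imem s' x = imem s x))"
proof -
  define Inv where "Inv q s' \<longleftrightarrow> imem s' ''p'' 0 = q \<and> produced s' = produced s \<and>
    pending s' = map Suc (filter (\<lambda>p. p \<notin> bits s) [0..<q]) \<and>
    (\<forall>x. x \<noteq> ''p'' \<longrightarrow> imem s' x = imem s x)" for q and s' :: state
  show ?thesis
    unfolding emit_facet_def
    apply (simp add: runs_simps)
    apply (rule runs_weaken[OF runs_count[where Inv = Inv and N = m and B = 25]])
    subgoal for q s' using in_bits[of q s] by (simp add: runs_simps Inv_def)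
    subgoal for s' by (simp add: Inv_def)
    subgoal using assms by (simp add: Inv_def)
    subgoal for t s' by (simp add: runs_simps Inv_def facet_list_def)
    done
qed

text \<open>Here \<open>k\<close> has the encoding of the program: it exceeds the position by 1, and 0 means none.\<close>

definition least_flip :: "nat set \<Rightarrow> nat \<Rightarrow> nat \<Rightarrow> bool" where
  "least_flip J lo k \<longleftrightarrow> (\<forall>p\<ge>lo. flippable J p \<longrightarrow> 0 < k \<and> k - 1 \<le> p) \<and>
     (0 < k \<longrightarrow> flippable J (k - 1))"

lemma runs_find_flip:
  "runs inp find_flip s cells (\<lambda>t s'. t \<le> 500 * m * m * n + 20 \<and>
    least_flip (bits s) 0 (imem s' ''k'' 0) \<and> frame {''i'', ''j'', ''k'', ''p'', ''x''} s s')"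
proof -
  let ?Y = "{''i'', ''j'', ''k'', ''p'', ''x''}" let ?J = "bits s"
  define Inv where "Inv c s' \<longleftrightarrow> imem s' ''p'' 0 = m - c \<and>
    least_flip ?J (m - c) (imem s' ''k'' 0) \<and> frame ?Y s s'" for c and s' :: state
  show ?thesis
    unfolding find_flip_def
    apply (simp add: runs_simps del: One_nat_def)
    apply (rule runs_weaken[OF runs_count[where Inv = Inv and N = m and B = "400 * m * n + 30"]])
    subgoal premises pr for c s'
    proof -
      let ?p = "m - Suc c"
      have p: "?p < m" "Suc ?p = m - c" using pr(1) by auto
      have s': "imem s' ''p'' 0 = m - c" "least_flip ?J (m - c) (imem s' ''k'' 0)" "frame ?Y s s'"
        using pr(2) by (auto simp: Inv_def)
      have bit: "0 < imem s' ''b'' ?p \<longleftrightarrow> ?p \<in> ?J"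
        using in_bits[OF p(1), of s] s'(3) by (simp add: frame_def)
      have keep: "least_flip ?J ?p (imem s' ''k'' 0)" if "\<not> flippable ?J ?p"
        using s'(2) that p(2) unfolding least_flip_def by (metis Suc_leI le_neq_implies_less)
      have new: "least_flip ?J ?p (Suc ?p)" if "flippable ?J ?p"
        using that by (simp add: least_flip_def)
      show ?thesis
      proof (intro conjI)
        show "bval inp s' (ILess (IConst 0) (var ''p''))" using s'(1) pr(1) by simp
        show "runs inp (decr ''p'' ;; IfElse (ILess (IConst 0) (IGet ''b'' (var ''p''))) Skip
            (right_test ;; IfElse (RLess (rvar ''h'') RZero)
              (assign ''k'' (IPlus (var ''p'') (IConst 1))) Skip)) s' cells
            (\<lambda>t s'. t \<le> 400 * m * n + 30 \<and> Inv (Suc c) s')"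
        proof (cases "?p \<in> ?J")
          case True
          then have nf: "\<not> flippable ?J ?p" by (simp add: flippable_def)
          have b: "0 < imem s' ''b'' (m - Suc c)" using True bit by simp
          show ?thesis
            using s' b keep[OF nf] by (simp add: runs_simps Inv_def frame_def)
        next
          case False
          have b: "\<not> 0 < imem s' ''b'' (m - Suc c)" using False bit by simp
          let ?s1 = "s'\<lparr>imem := (imem s')(''p'' := (imem s' ''p'')(0 := ?p))\<rparr>"
          have p1: "imem ?s1 ''p'' 0 = ?p" by simp
          have b1: "bits ?s1 = ?J" using s'(3) by (auto simp: bits_def frame_def)
          show ?thesis
            apply (simp add: runs_simps s'(1) b)
            apply (rule runs_weaken[OF runs_right_test[where s = ?s1, OF p1 p(1), unfolded b1]])
            subgoal premises pr2 for t s2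
            proof -
              have s2: "t \<le> 400 * m * n" "represents s2 (act (used_word ?J 0 ?p) (\<Delta> ! (Q ! ?p)))"
                "frame {''i'', ''j'', ''x''} ?s1 s2" using pr2 by auto
              have f: "frame ?Y s s2" using s'(3) s2(3) by (auto simp: frame_def)
              have v: "imem s2 ''p'' 0 = ?p" "imem s2 ''k'' 0 = imem s' ''k'' 0"
                using s2(3) by (auto simp: frame_def)
              have h: "rmem s2 ''h'' 0 0 < 0 \<longleftrightarrow> flippable ?J ?p"
                using s2(2) False p(1) by (simp add: represents_def flippable_def descent_def)
              show ?thesis
                using s2(1) v f h keep new by (auto simp: Inv_def frame_def)
            qed
            done
        qed
      qed
    qed
    subgoal for s' by (simp add: Inv_def)
    subgoal by (auto simp: Inv_def frame_def least_flip_def flippable_def)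
    subgoal premises pr for t s'
    proof -
      have inv: "least_flip ?J 0 (imem s' ''k'' 0)" "frame ?Y s s'"
        using pr by (auto simp: Inv_def)
      have "t \<le> m * (400 * m * n + 35) + 5" using pr by (auto simp: algebra_simps)
      also have "m * (400 * m * n + 35) \<le> m * (500 * m * n)"
      proof (cases "m = 0")
        case False
        then have "1 * 1 \<le> m * n" using rank_pos by (intro mult_le_mono) (auto simp: Suc_le_eq)
        then have "400 * m * n + 35 \<le> 500 * m * n" unfolding mult.assoc by linarith
        then show ?thesis by (intro mult_le_mono) auto
      qed simp
      finally show ?thesis using inv by (simp add: algebra_simps)
    qed
    done
qed

section \<open>The enumeration\<close>

definition free_positions :: "nat set \<Rightarrow> nat set" where
  "free_positions J = Suc ` ({..<m} - J)"

lemma set_facet_list: "set (facet_list J) = free_positions J"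
  by (auto simp: facet_list_def free_positions_def)

lemma inj_free_positions: "inj_on free_positions {J. expresses J}"
proof (rule inj_onI)
  fix J J' assume J: "J \<in> {J. expresses J}" "J' \<in> {J. expresses J}" "free_positions J = free_positions J'"
  then have "{..<m} - J = {..<m} - J'" by (simp add: free_positions_def inj_image_eq_iff)
  moreover have "J \<subseteq> {..<m}" "J' \<subseteq> {..<m}" using J by (auto simp: expresses_def)
  ultimately show "J = J'" by blast
qed

lemma finite_expresses: "finite {J. expresses J}"
  by (rule finite_subset[of _ "Pow {..<m}"]) (auto simp: expresses_def)

lemma runs_enumerate_step:
  assumes J: "expresses (bits s)" and s: "pending s = []" "0 < imem s ''g'' 0"
  shows "runs inp enumerate_step s cells (\<lambda>t s'. t \<le> 40 * m + 1600 * m * m * n + 100 \<and>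
    pending s' = [] \<and> produced s' = produced s @ [facet_list (bits s)] \<and>
    (0 < imem s' ''g'' 0 \<and> (\<exists>k. successor (bits s) k (bits s')) \<or>
     imem s' ''g'' 0 = 0 \<and> (\<forall>p<m. \<not> flippable (bits s) p)))"
  unfolding enumerate_step_def runs_Seq[of inp emit_facet] runs_Seq[of inp find_flip]
proof (rule runs_weaken[OF runs_emit_facet[OF s(1)]], elim conjE, goal_cases)
  case (1 t1 s1)
  have b1: "bits s1 = bits s" using 1 by (simp add: bits_def)
  show ?case
  proof (rule runs_weaken[OF runs_find_flip], elim conjE, goal_cases)
    case (1 t2 s2)
    note s1 = \<open>t1 \<le> _\<close> \<open>pending s1 = _\<close> \<open>produced s1 = _\<close> \<open>\<forall>x. _\<close>
    have b2: "bits s2 = bits s" using bits_frame[OF 1(3)] b1 by simp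
    have s2: "pending s2 = []" "produced s2 = produced s @ [facet_list (bits s)]" "0 < imem s2 ''g'' 0"
      using 1(3) s1 s(2) by (auto simp: frame_def)
    have lf: "least_flip (bits s) 0 (imem s2 ''k'' 0)" using 1(2) b1 by simp
    show ?case
    proof (cases "imem s2 ''k'' 0")
      case 0
      then have "\<forall>p<m. \<not> flippable (bits s) p" using lf by (simp add: least_flip_def)
      then show ?thesis using 0 s2 1(1) s1(1) by (simp add: runs_simps)
    next
      case (Suc q)
      have fl: "flippable (bits s) q" "\<forall>p<q. \<not> flippable (bits s) p"
        using lf Suc by (auto simp: least_flip_def)
      then have q: "q < m" by (simp add: flippable_def)
      let ?s3 = "s2\<lparr>imem := (imem s2)(''k'' := (imem s2 ''k'')(0 := q), ''b'' := (imem s2 ''b'')(q := 1))\<rparr>"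
      have b3: "bits ?s3 = insert q (bits s)"
        using q unfolding b2[symmetric] by (auto simp: bits_def)
      have k3: "imem ?s3 ''k'' 0 = q" by simp
      show ?thesis
        using Suc q
        apply (simp add: runs_simps)
        apply (rule runs_weaken[OF runs_refill[where s = ?s3, OF k3 less_imp_le[OF q], unfolded b3, simplified]])
        subgoal premises pr for t s'
        proof -
          have G: "\<forall>i\<ge>q. i \<in> bits s' \<longleftrightarrow> i = q \<or> i \<in> bits s"
            "left_greedy (used_word (bits s') q m @ rev r) (bits s') q"
            and f: "frame {''b'', ''i'', ''j'', ''p'', ''x''} ?s3 s'" and t: "t \<le> 1100 * m * m * n + 20"
            using pr by auto
          have "successor (bits s) q (bits s')"
            using fl G by (auto simp: successor_def bits_def)
          moreover have "imem s' ''g'' 0 = imem s2 ''g'' 0" "pending s' = []" "produced s' = produced s2"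
            using f s2 by (auto simp: frame_def)
          ultimately show ?thesis using s2 t 1(1) s1(1) by auto
        qed
        done
    qed
  qed
qed

lemma runs_enumerate_facets:
  "runs inp enumerate_facets init_state cells (\<lambda>t s.
     t \<le> card {J. expresses J} * (5000 * max 1 (m\<^sup>2 * n)) \<and>
     distinct (map set (produced s)) \<and> set (map set (produced s)) = free_positions ` {J. expresses J})"
proof -
  let ?N = "card {J. expresses J}" let ?F = free_positions let ?M = "max 1 (m\<^sup>2 * n)"
  \<comment> \<open>After \<open>c\<close> rounds exactly the sets below the current one have been output, and there are \<open>c\<close> of
    them. Hence the flag \<open>g\<close> is cleared exactly when \<open>c\<close> reaches the number of facets.\<close>
  define Inv where "Inv c s \<longleftrightarrow> pending s = [] \<and> length (produced s) = c \<and>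
    distinct (map set (produced s)) \<and>
    (0 < imem s ''g'' 0 \<and> expresses (bits s) \<and>
       set (map set (produced s)) = ?F ` {C. expresses C \<and> C \<sqsubset> bits s} \<or>
     imem s ''g'' 0 = 0 \<and> set (map set (produced s)) = ?F ` {C. expresses C})" for c and s :: state
  have count: "c = card X" if "Inv c s" "set (map set (produced s)) = ?F ` X" "X \<subseteq> {C. expresses C}" for c s X
  proof -
    have "c = card (set (map set (produced s)))" using that(1) distinct_card by (fastforce simp: Inv_def)
    also have "\<dots> = card X"
      unfolding that(2) by (rule card_image[OF inj_on_subset[OF inj_free_positions that(3)]])
    finally show ?thesis .
  qed
  have more: "c < ?N" if "Inv c s" "expresses (bits s)"
    "set (map set (produced s)) = ?F ` {C. expresses C \<and> C \<sqsubset> bits s}" for c s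
  proof -
    have "{C. expresses C \<and> C \<sqsubset> bits s} \<subset> {C. expresses C}" using that below_irrefl by blast
    then have "card {C. expresses C \<and> C \<sqsubset> bits s} < ?N" by (rule psubset_card_mono[OF finite_expresses])
    moreover have "c = card {C. expresses C \<and> C \<sqsubset> bits s}" by (rule count[OF that(1,3)]) blast
    ultimately show ?thesis by simp
  qed
  have finished: "imem s ''g'' 0 = 0" if "Inv ?N s" for s
  proof (rule ccontr)
    assume "imem s ''g'' 0 \<noteq> 0"
    then have "expresses (bits s)"
      "set (map set (produced s)) = ?F ` {C. expresses C \<and> C \<sqsubset> bits s}"
      using that by (simp_all add: Inv_def)
    from more[OF that this] show False by simp
  qed
  have N: "1 \<le> ?N" using expressible finite_expresses by (simp add: Suc_le_eq card_gt_0_iff)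
  have mM: "m * m * n \<le> ?M" by (simp add: power2_eq_square)
  have m1: "m \<le> ?M"
  proof (cases "m = 0")
    case False
    then have "m * 1 \<le> m * (m * n)" using rank_pos by (intro mult_le_mono) (auto simp: Suc_le_eq)
    then show ?thesis using mM unfolding mult_1_right mult.assoc by linarith
  qed simp
  define s0 where "s0 = init_state\<lparr>imem := (imem init_state)(''k'' := (imem init_state ''k'')(0 := m))\<rparr>"
  have k0: "imem s0 ''k'' 0 = m" by (simp add: s0_def)
  show ?thesis
    unfolding enumerate_facets_def
    apply (simp add: runs_simps del: One_nat_def)
    unfolding s0_def[symmetric]
    apply (rule runs_weaken[OF runs_refill[OF k0 order_refl]])
    subgoal premises pr for t0 s1
    proof -
      have s1: "t0 \<le> 1100 * m * m * n + 20" "left_greedy (rev r) (bits s1) m"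
        "frame {''b'', ''i'', ''j'', ''p'', ''x''} s0 s1" using pr by auto
      obtain J where "expresses J" using expressible by blast
      moreover have "bits s1 \<subseteq> {..<m}" by (auto simp: bits_def)
      ultimately have first: "expresses (bits s1)" using first_expresses s1(2) by blast
      have none: "{C. expresses C \<and> C \<sqsubset> bits s1} = {}" using first_least[OF first s1(2)] by blast
      have out: "pending s1 = []" "produced s1 = []"
        using s1(3) by (auto simp: frame_def s0_def init_state_def)
      show ?thesis
        apply (rule runs_weaken[OF runs_count[where Inv = Inv and N = ?N and B = "1740 * ?M"]])
        subgoal premises pr for c s
        proof -
          have "imem s ''g'' 0 \<noteq> 0"
          proof
            assume "imem s ''g'' 0 = 0"
            then have "set (map set (produced s)) = ?F ` {C. expresses C}" using pr(2) by (simp add: Inv_def)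
            from count[OF pr(2) this] show False using pr(1) by simp
          qed
          then have s: "0 < imem s ''g'' 0" "expresses (bits s)" "pending s = []"
            "length (produced s) = c" "distinct (map set (produced s))"
            "set (map set (produced s)) = ?F ` {C. expresses C \<and> C \<sqsubset> bits s}"
            using pr(2) by (auto simp: Inv_def)
          have "?F (bits s) \<notin> ?F ` {C. expresses C \<and> C \<sqsubset> bits s}"
            using inj_free_positions s(2) below_irrefl by (auto simp: inj_on_def)
          then have dist: "distinct (map set (produced s @ [facet_list (bits s)]))"
            using s(5,6) by (simp add: set_facet_list)
          have prod: "set (map set (produced s @ [facet_list (bits s)])) =
              ?F ` {C. expresses C \<and> (C \<sqsubset> bits s \<or> C = bits s)}"
            using s(2,6) by (auto simp: set_facet_list)
          show ?thesis
          proof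
            show "bval inp s (ILess (IConst 0) (var ''g''))" using s(1) by simp
            show "runs inp enumerate_step s cells (\<lambda>t s'. t \<le> 1740 * ?M \<and> Inv (Suc c) s')"
            proof (rule runs_weaken[OF runs_enumerate_step[OF s(2,3,1)]], elim conjE disjE exE, goal_cases)
              case (1 t s' k)
              have "expresses (bits s')" using successor_expresses[OF s(2)] 1 by blast
              moreover have "{C. expresses C \<and> (C \<sqsubset> bits s \<or> C = bits s)} = {C. expresses C \<and> C \<sqsubset> bits s'}"
                using below_successor_iff[OF s(2)] 1 by blast
              moreover have "t \<le> 1740 * ?M" using 1(1) mM m1 unfolding mult.assoc by linarith
              ultimately show ?case using 1 dist prod s(4) by (simp add: Inv_def)
            next
              case (2 t s')
              have "{C. expresses C \<and> (C \<sqsubset> bits s \<or> C = bits s)} = {C. expresses C}"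
                using last_if_not_flippable[OF s(2)] 2 by blast
              moreover have "t \<le> 1740 * ?M" using 2(1) mM m1 unfolding mult.assoc by linarith
              ultimately show ?case using 2 dist prod s(4) by (simp add: Inv_def)
            qed
          qed
        qed
        subgoal for s using finished by simp
        subgoal using out first none by (simp add: Inv_def bits_def)
        subgoal premises pr for t s
        proof -
          have inv: "Inv ?N s" and t: "t \<le> ?N * (1740 * ?M + 5) + 5" using pr by (auto simp: algebra_simps)
          have "t0 \<le> 1100 * ?M + 20" using s1(1) mM unfolding mult.assoc by linarith
          also have "\<dots> \<le> ?N * (1100 * ?M + 20)" using mult_le_mono1[OF N] unfolding mult_1 .
          finally have "t0 + t + 20 \<le> ?N * (1100 * ?M + 20) + ?N * (1740 * ?M + 5) + ?N * 25"
            using t N by linarith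
          also have "\<dots> = ?N * (2840 * ?M + 50)" by (simp add: algebra_simps)
          also have "\<dots> \<le> ?N * (5000 * ?M)" by (intro mult_le_mono) auto
          finally have "t0 + t + 20 \<le> ?N * (5000 * ?M)" .
          moreover have "set (map set (produced s)) = ?F ` {C. expresses C}"
            using finished[OF inv] inv by (simp add: Inv_def)
          ultimately show ?thesis using inv by (simp add: Inv_def)
        qed
        done
    qed
    done
qed

lemma card_cells: "card cells \<le> 12 * max 1 (m * n)"
proof -
  have "card cells \<le> card ((\<lambda>x. ICell x 0) ` {''g'', ''i'', ''j'', ''k'', ''p'', ''x''} \<union>
     (\<lambda>x. RCell x 0 0) ` {''a'', ''d'', ''h''}) + card (ICell ''b'' ` {..<m}) +
     card (if m = 0 then {} else RCell ''v'' 0 ` {..<n})"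
    unfolding cells_def by (intro order.trans[OF card_Un_le] add_mono order_refl card_Un_le)
  also have "card ((\<lambda>x. ICell x 0) ` {''g'', ''i'', ''j'', ''k'', ''p'', ''x''} \<union>
     (\<lambda>x. RCell x 0 0) ` {''a'', ''d'', ''h''}) = 9" by simp
  also have "card (ICell ''b'' ` {..<m}) \<le> m" using card_image_le[of "{..<m}"] by simp
  also have "card (if m = 0 then {} else RCell ''v'' 0 ` {..<n}) \<le> (if m = 0 then 0 else n)"
    using card_image_le[of "{..<n}" "RCell ''v'' 0"] by simp
  also have "9 + m + (if m = 0 then 0 else n) \<le> 12 * max 1 (m * n)"
  proof (cases "m = 0")
    case False
    then have "m * 1 \<le> m * n" "1 * n \<le> m * n" using rank_pos by (auto intro!: mult_le_mono simp: Suc_le_eq)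
    moreover have "1 \<le> m" using False by linarith
    ultimately show ?thesis using False unfolding mult_1_right mult_1 by (simp only: if_False)
  qed simp
  finally show ?thesis by simp
qed

end

section \<open>Reduced expressions in the reflection group\<close>

lemma mat_eq_if_same_action:
  assumes "A \<in> carrier_mat n n" "B \<in> carrier_mat n n"
    and "\<And>x. x \<in> carrier_vec n \<Longrightarrow> A *\<^sub>v x = B *\<^sub>v (x :: real vec)"
  shows "A = B"
proof (rule eq_matI)
  fix i j assume ij: "i < dim_row B" "j < dim_col B"
  then have "(A *\<^sub>v unit_vec n j) $ i = (B *\<^sub>v unit_vec n j) $ i" using assms(3) by simp
  then show "A $$ (i, j) = B $$ (i, j)" using assms(1,2) ij by simp
qed (use assms in auto)

lemma nths_conv_filter: "nths xs A = map ((!) xs) (filter (\<lambda>i. i \<in> A) [0..<length xs])"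
proof -
  have "zip xs [0..<length xs] = map (\<lambda>i. (xs ! i, i)) [0..<length xs]"
    by (intro nth_equalityI) auto
  then show ?thesis by (simp add: nths_def filter_map o_def)
qed

context simple_system
begin

abbreviation W :: "real mat monoid" where "W \<equiv> reflection_group n \<Phi>"
abbreviation S :: "real mat set" where "S \<equiv> simple_reflections n \<Delta>"
abbreviation elem :: "nat list \<Rightarrow> real mat" where "elem w \<equiv> word_prod W (word_of n \<Delta> w)"

lemma elem_carrier_act:
  assumes "set w \<subseteq> {..<n}"
  shows "elem w \<in> carrier_mat n n \<and> (\<forall>x\<in>carrier_vec n. elem w *\<^sub>v x = act w x)"
  using assms
proof (induction w)
  case Nil
  then show ?case
    by (simp add: word_prod_def word_of_def reflection_group_def subgroup_generated_def units_of_def ring_mat_def)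
next
  case (Cons i w)
  have R: "refl_mat n (\<Delta> ! i) \<in> carrier_mat n n" by (simp add: refl_mat_def)
  have "elem (i # w) = refl_mat n (\<Delta> ! i) * elem w"
    by (simp add: word_prod_def word_of_def reflection_group_def subgroup_generated_def units_of_def ring_mat_def)
  then show ?case
    using Cons R by (auto simp: simple_refl_def assoc_mult_mat_vec[OF R])
qed

lemma elem_eq_iff:
  assumes "set u \<subseteq> {..<n}" "set v \<subseteq> {..<n}" shows "elem u = elem v \<longleftrightarrow> u \<approx> v"
proof
  show "elem u = elem v \<Longrightarrow> u \<approx> v"
    unfolding weq_def using elem_carrier_act assms by metis
  show "u \<approx> v \<Longrightarrow> elem u = elem v"
    using elem_carrier_act assms by (intro mat_eq_if_same_action[where n = n]) (auto simp: weq_def)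
qed

lemma length_word_of: "length (word_of n \<Delta> w) = length w"
  by (simp add: word_of_def)

lemma word_of_in_lists: "set w \<subseteq> {..<n} \<Longrightarrow> word_of n \<Delta> w \<in> lists S"
  by (auto simp: word_of_def simple_reflections_def length_simple subset_eq intro!: imageI nth_mem)

text \<open>Minimality among words in the simple reflections implies minimality among all words, because
  dropping the letters \<open>i \<ge> n\<close> changes no action.\<close>

lemma reduced_expression_reduced:
  assumes r: "set r \<subseteq> {..<n}" "reduced_expression W S (word_of n \<Delta> r) \<rho>"
  shows "reduced r"
  unfolding reduced_def
proof (intro allI impI)
  fix u assume u: "u \<approx> r"
  let ?u = "filter (\<lambda>i. i < n) u"
  have "act ?u x = act u x" for x by (induction u) (auto simp: simple_refl_def)
  then have "?u \<approx> r" using u by (simp add: weq_def)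
  then have "elem ?u = \<rho>" using elem_eq_iff[of ?u r] r by (auto simp: reduced_expression_def)
  then have "coxeter_length W S \<rho> \<le> length ?u"
    unfolding coxeter_length_def
    by (intro Least_le bexI[of _ "word_of n \<Delta> ?u"] word_of_in_lists) (auto simp: length_word_of)
  then have "length r \<le> length ?u" using r by (simp add: reduced_expression_def length_word_of)
  then show "length r \<le> length u" using length_filter_le order.trans by blast
qed

lemma reduced_expression_iff:
  assumes "set r \<subseteq> {..<n}" "reduced_expression W S (word_of n \<Delta> r) \<rho>" "set w \<subseteq> {..<n}"
  shows "reduced_expression W S (word_of n \<Delta> w) \<rho> \<longleftrightarrow> w \<approx> r \<and> length w = length r"
proof -
  have "elem r = \<rho>" "length r = coxeter_length W S \<rho>"
    using assms(2) by (simp_all add: reduced_expression_def length_word_of)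
  then show ?thesis
    using elem_eq_iff[OF assms(3,1)] word_of_in_lists[OF assms(3)]
    by (simp add: reduced_expression_def length_word_of)
qed

end

context subword_problem
begin

lemma set_used_word: "set (used_word J 0 m) \<subseteq> {..<n}"
  by (auto simp: used_word_def)

lemma subword_word_of: "subword (word_of n \<Delta> Q) J = word_of n \<Delta> (used_word {p. Suc p \<in> J} 0 m)"
  by (simp add: subword_def word_of_def nths_map nths_conv_filter used_word_def)

lemma subword_reduced_expression_iff:
  assumes r: "reduced_expression W S (word_of n \<Delta> r) \<rho>" and J: "J \<subseteq> {1..m}"
  shows "reduced_expression W S (subword (word_of n \<Delta> Q) J) \<rho> \<longleftrightarrow> expresses {p. Suc p \<in> J}"
  using J reduced_expression_iff[OF r_letters r set_used_word]
  by (auto simp: subword_word_of expresses_def)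

text \<open>All position sets of reduced expressions of \<open>\<rho>\<close> have the same cardinality, so no complement of
  such a set is properly contained in another one.\<close>

lemma facets_subword_complex:
  assumes r: "reduced_expression W S (word_of n \<Delta> r) \<rho>"
  shows "facets (subword_complex W S (word_of n \<Delta> Q) \<rho>) = (\<lambda>J. Suc ` ({..<m} - J)) ` {J. expresses J}"
proof -
  let ?F = "\<lambda>J. Suc ` ({..<m} - J)" let ?K = "subword_complex W S (word_of n \<Delta> Q) \<rho>"
  have compl: "{1..m} - J = ?F {p. Suc p \<in> J}" for J
    unfolding image_Suc_lessThan[symmetric] by auto
  have K: "?K = {F. \<exists>J. expresses J \<and> F \<subseteq> ?F J}"
  proof (intro Set.set_eqI iffI)
    fix F assume "F \<in> ?K"
    then show "F \<in> {F. \<exists>J. expresses J \<and> F \<subseteq> ?F J}"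
      using subword_reduced_expression_iff[OF r] compl
      unfolding subword_complex_def length_word_of by fastforce
  next
    fix F assume "F \<in> {F. \<exists>J. expresses J \<and> F \<subseteq> ?F J}"
    then obtain J where J: "expresses J" "F \<subseteq> ?F J" by blast
    have s: "{p. Suc p \<in> Suc ` J} = J" by auto
    have sub: "Suc ` J \<subseteq> {1..m}" using J by (auto simp: expresses_def)
    have "reduced_expression W S (subword (word_of n \<Delta> Q) (Suc ` J)) \<rho>"
      using subword_reduced_expression_iff[OF r sub] J unfolding s by simp
    moreover have "F \<subseteq> {1..m} - Suc ` J" using compl[of "Suc ` J"] J unfolding s by simp
    ultimately show "F \<in> ?K" using sub unfolding subword_complex_def length_word_of by blast
  qed
  have eq: "J = J'" if "expresses J" "expresses J'" "?F J \<subseteq> ?F J'" for J J'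
  proof -
    have s: "J \<subseteq> {..<m}" "J' \<subseteq> {..<m}" "card J = card J'"
      using that length_used_word by (auto simp: expresses_def)
    have "J' \<subseteq> J" using that(3) s by auto
    then show ?thesis using s card_subset_eq finite_subset by (metis finite_lessThan)
  qed
  show ?thesis
  proof (intro Set.set_eqI iffI)
    fix F assume "F \<in> facets ?K"
    then show "F \<in> ?F ` {J. expresses J}" unfolding facets_def K by blast
  next
    fix F assume "F \<in> ?F ` {J. expresses J}"
    then obtain J where J: "expresses J" "F = ?F J" by blast
    have "F' = F" if F': "F' \<in> ?K" "F \<subseteq> F'" for F'
    proof -
      obtain J' where J': "expresses J'" "F' \<subseteq> ?F J'" using F' K by blast
      then have "J = J'" using eq[OF J(1) J'(1)] F'(2) J(2) by blast
      then show ?thesis using J J' F' by blast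
    qed
    then show "F \<in> facets ?K" unfolding facets_def using J K by blast
  qed
qed

end

theorem mainTheorem2:
  shows "\<exists>(greedy_flip :: com) (C :: real).
    \<forall>(n :: nat) (W :: real mat monoid) (S :: real mat set) (\<Phi> :: real vec set) (\<Delta> :: real vec list)
      (Q :: nat list) (\<rho> :: real mat) (r :: nat list).
      finite_coxeter_data n W S \<Phi> \<Delta> \<longrightarrow>
      set Q \<subseteq> {..<n} \<longrightarrow>
      \<rho> \<in> carrier W \<longrightarrow>
      (\<exists>J \<subseteq> {1..length Q}. reduced_expression W S (subword (word_of n \<Delta> Q) J) \<rho>) \<longrightarrow>
      set r \<subseteq> {..<n} \<longrightarrow>
      reduced_expression W S (word_of n \<Delta> r) \<rho> \<longrightarrow>
      (let m = length Q;
           K = facets (subword_complex W S (word_of n \<Delta> Q) \<rho>);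
           I = \<lparr>in_rank = n, in_word = Q, in_roots = \<Delta>, in_elem = r\<rparr>
       in \<exists>t U s. exec I greedy_flip init_state t U s \<and>
            distinct (map set (produced s)) \<and> set (map set (produced s)) = K \<and>
            real t / real (card K) \<le> C * real (max 1 (m ^ 2 * n)) \<and>
            real (card U) \<le> C * real (max 1 (m * n)))"
proof (rule exI[of _ enumerate_facets], rule exI[of _ 5000], intro allI impI)
  fix n W S \<Phi> \<Delta> Q \<rho> r
  assume data: "finite_coxeter_data n W S \<Phi> \<Delta>" and Q: "set Q \<subseteq> {..<n}"
    and Qr: "\<exists>J \<subseteq> {1..length Q}. reduced_expression W S (subword (word_of n \<Delta> Q) J) \<rho>"
    and r: "set r \<subseteq> {..<n}" "reduced_expression W S (word_of n \<Delta> r) \<rho>"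
  have WS: "W = reflection_group n \<Phi>" "S = simple_reflections n \<Delta>"
    using data by (simp_all add: finite_coxeter_data_def)
  interpret simple_system n \<Phi> \<Delta>
    using data by unfold_locales (simp_all add: finite_coxeter_data_def)
  interpret subword_problem n \<Phi> \<Delta> Q r
    using Q r reduced_expression_reduced unfolding WS by unfold_locales auto
  interpret expressible_problem n \<Phi> \<Delta> Q r
    using Qr subword_reduced_expression_iff r(2) unfolding WS by unfold_locales blast
  let ?K = "facets (subword_complex W S (word_of n \<Delta> Q) \<rho>)"
  have K: "?K = free_positions ` {J. expresses J}"
    using facets_subword_complex r(2) unfolding WS by (simp add: free_positions_def)
  have card_K: "card ?K = card {J. expresses J}"
    unfolding K by (rule card_image[OF inj_free_positions])
  obtain t U s where run: "exec inp enumerate_facets init_state t U s" "U \<subseteq> cells"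
    and t: "t \<le> card ?K * (5000 * max 1 ((length Q)\<^sup>2 * n))"
    and out: "distinct (map set (produced s))" "set (map set (produced s)) = ?K"
    using runs_enumerate_facets unfolding runs_def K[symmetric] card_K[symmetric] by blast
  have "0 < card ?K" using expressible finite_expresses unfolding card_K by (auto simp: card_gt_0_iff)
  moreover have "real t \<le> real (card ?K) * (5000 * real (max 1 ((length Q)\<^sup>2 * n)))"
    using of_nat_mono[OF t, where 'a = real] by simp
  ultimately have "real t / real (card ?K) \<le> 5000 * real (max 1 ((length Q)\<^sup>2 * n))"
    by (simp add: pos_divide_le_eq mult.commute)
  moreover have "card U \<le> 12 * max 1 (length Q * n)"
    using card_mono[OF finite_cells run(2)] card_cells by linarith
  then have "real (card U) \<le> 5000 * real (max 1 (length Q * n))"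
    by linarith
  ultimately show "let m = length Q;
           K = facets (subword_complex W S (word_of n \<Delta> Q) \<rho>);
           I = \<lparr>in_rank = n, in_word = Q, in_roots = \<Delta>, in_elem = r\<rparr>
       in \<exists>t U s. exec I enumerate_facets init_state t U s \<and>
            distinct (map set (produced s)) \<and> set (map set (produced s)) = K \<and>
            real t / real (card K) \<le> 5000 * real (max 1 (m ^ 2 * n)) \<and>
            real (card U) \<le> 5000 * real (max 1 (m * n))"
    using run(1) out by (auto simp: Let_def)
qed

end
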